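(* Let $n\ge 1$ and let $\Omega\subset\mathbb{C}^n$ be a bounded starlike circular domain with $0\in\Omega$, whose Minkowski functional $\rho$ is of class $\mathcal{C}^1$ except on some lower-dimensional manifolds $E\subset\mathbb{C}^n$. Let $f:\Omega\to\mathbb{C}$ be holomorphic with $f(0)=1$, and let $F:\Omega\to\mathbb{C}^n$ be defined by $F(z)=z f(z)$ (the scalar $f(z)$ times the vector $z$). If $F\in\mathcal{S}^*(\Omega)$, then for every $z\in\Omega\setminus E$, $$\left| \left(2 \frac{\partial \rho(z)}{\partial z}\frac{D^{2} F(0)(z^{2})}{2!\, \rho^{2}(z)}\right)\left(2 \frac{\partial \rho(z)}{\partial z}\frac{D^{3} F(0)(z^{3})}{3!\, \rho^{3}(z)}\right) -2 \frac{\partial \rho(z)}{\partial z}\frac{D^{4} F(0)(z^{4})}{4!\, \rho^{4}(z)}\right| \leq 2 .$$ The bound is sharp, i.e. the constant $2$ on the right-hand side cannot be replaced by any smaller constant valid for all such $F$ and $z$.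
   Context: A bounded starlike circular domain $\Omega\subset\mathbb{C}^n$ with $0\in\Omega$ is characterized by its Minkowski functional: the unique continuous function $\rho:\mathbb{C}^n\to\mathbb{R}$ such that (i) $\rho(z)\ge 0$ for all $z$, with $\rho(z)=0$ if and only if $z=0$; (ii) $\rho(tz)=|t|\rho(z)$ for $t\in\mathbb{C}$, $z\in\mathbb{C}^n$; (iii) $\Omega=\{z\in\mathbb{C}^n:\rho(z)<1\}$. It is assumed that $\rho$ is of class $\mathcal{C}^1$ (in the real sense) outside an exceptional set $E$ consisting of lower-dimensional manifolds in $\mathbb{C}^n$ (real dimension less than $2n$). Necessarily $0\in E$, as $\rho$ is not differentiable at $0$. For $z\in\mathbb{C}^n\setminus E$, $\frac{\partial \rho(z)}{\partial z}=\left(\frac{\partial\rho(z)}{\partial z_1},\dots,\frac{\partial\rho(z)}{\partial z_n}\right)$ is the row vector of Wirtinger derivatives $\frac{\partial}{\partial z_j}=\frac12\left(\frac{\partial}{\partial x_j}-i\frac{\partial}{\partial y_j}\right)$, $z_j=x_j+iy_j$. Elements of $\mathbb{C}^n$ are column vectors, and $\frac{\partial\rho(z)}{\partial z}v=\sum_j \frac{\partial\rho(z)}{\partial z_j}v_j$ for $v\in\mathbb{C}^n$. For a holomorphic map $F:\Omega\to\mathbb{C}^n$, $DF(z)$ is its complex Jacobian matrix, $D^mF(0)$ is its $m$-th Fréchet derivative at $0$ (a symmetric $m$-linear map), and $D^mF(0)(z^m)=D^mF(0)(z,\dots,z)$ ($m$ times). $F$ is normalized if $F(0)=0$ and $DF(0)=I$,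 and locally biholomorphic if $DF(z)$ is invertible for every $z\in\Omega$. $\mathcal{S}^*(\Omega)$ (starlike mappings on $\Omega$) is the class of all normalized locally biholomorphic mappings $F:\Omega\to\mathbb{C}^n$ such that $$\operatorname{Re}\left(\frac{\partial\rho(z)}{\partial z}\,(DF(z))^{-1}F(z)\right)>0\quad\text{for all } z\in\Omega\setminus E.$$ *)

theory Defs
  imports "HOL-Analysis.Analysis"
begin

definition bounded_starlike_circular_domain :: "(complex ^ 'n) set \<Rightarrow> bool" where
  "bounded_starlike_circular_domain \<Omega> \<longleftrightarrow>
     open \<Omega> \<and> connected \<Omega> \<and> bounded \<Omega> \<and> 0 \<in> \<Omega> \<and>
     (\<forall>z\<in>\<Omega>. closed_segment 0 z \<subseteq> \<Omega>) \<and>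
     (\<forall>z\<in>\<Omega>. \<forall>t::complex. cmod t = 1 \<longrightarrow> t *s z \<in> \<Omega>)"

definition is_minkowski_functional ::
    "(complex ^ 'n \<Rightarrow> real) \<Rightarrow> (complex ^ 'n) set \<Rightarrow> bool" where
  "is_minkowski_functional \<rho> \<Omega> \<longleftrightarrow>
     continuous_on UNIV \<rho> \<and>
     (\<forall>z. \<rho> z \<ge> 0 \<and> (\<rho> z = 0 \<longleftrightarrow> z = 0)) \<and>
     (\<forall>t z. \<rho> (t *s z) = cmod t * \<rho> z) \<and>
     \<Omega> = {z. \<rho> z < 1}"

(* An embedded k-dimensional topological manifold (without boundary); the k-dimensional
   real subspace T plays the role of R^k, and dim is the dimension over the reals. *)
definition embedded_manifold :: "nat \<Rightarrow> 'a::euclidean_space set \<Rightarrow> bool" where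
  "embedded_manifold k M \<longleftrightarrow>
     (\<forall>x\<in>M. \<exists>U T V. openin (top_of_set M) U \<and> x \<in> U \<and>
        subspace (T :: 'a set) \<and> dim T = k \<and> openin (top_of_set T) V \<and> U homeomorphic V)"

(* Only countably many manifolds are allowed: every set is a union of points. *)
definition consists_of_lower_dim_manifolds :: "'a::euclidean_space set \<Rightarrow> bool" where
  "consists_of_lower_dim_manifolds E \<longleftrightarrow>
     (\<exists>\<M>. countable \<M> \<and> E = \<Union>\<M> \<and> (\<forall>M\<in>\<M>. \<exists>k < DIM('a). embedded_manifold k M))"

definition C1_outside :: "('a::euclidean_space \<Rightarrow> real) \<Rightarrow> 'a set \<Rightarrow> bool" where
  "C1_outside \<rho> E \<longleftrightarrow>
     (\<exists>\<rho>' :: 'a \<Rightarrow> 'a \<Rightarrow>\<^sub>L real.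
        (\<forall>z\<in>-E. (\<rho> has_derivative blinfun_apply (\<rho>' z)) (at z)) \<and> continuous_on (-E) \<rho>')"

definition wirtinger_row :: "(complex ^ 'n \<Rightarrow> real) \<Rightarrow> complex ^ 'n \<Rightarrow> complex ^ 'n" where
  "wirtinger_row \<rho> z = (\<chi> j.
     (complex_of_real (deriv (\<lambda>t::real. \<rho> (z + axis j (of_real t))) 0)
      - \<i> * complex_of_real (deriv (\<lambda>t::real. \<rho> (z + axis j (\<i> * of_real t))) 0)) / 2)"

definition row_apply :: "complex ^ 'n \<Rightarrow> complex ^ 'n \<Rightarrow> complex" where
  "row_apply r v = (\<Sum>j\<in>UNIV. r $ j * v $ j)"

(* Holomorphy in several variables: the real Frechet derivative is complex-linear. *)
definition holomorphic_fun_on :: "(complex ^ 'n \<Rightarrow> complex) \<Rightarrow> (complex ^ 'n) set \<Rightarrow> bool" where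
  "holomorphic_fun_on f S \<longleftrightarrow>
     (\<forall>z\<in>S. \<exists>D. (f has_derivative D) (at z) \<and> Vector_Spaces.linear (*s) (*) D)"

definition holomorphic_map_on ::
    "(complex ^ 'n \<Rightarrow> complex ^ 'n) \<Rightarrow> (complex ^ 'n) set \<Rightarrow> bool" where
  "holomorphic_map_on F S \<longleftrightarrow>
     (\<forall>z\<in>S. \<exists>D. (F has_derivative D) (at z) \<and> Vector_Spaces.linear (*s) (*s) D)"

definition complex_jacobian ::
    "(complex ^ 'n \<Rightarrow> complex ^ 'n) \<Rightarrow> complex ^ 'n \<Rightarrow> complex ^ 'n ^ 'n" where
  "complex_jacobian F z = matrix (frechet_derivative F (at z))"

(* iterated_frechet F [v1, ..., vm] z is D^m F(z)(v1, ..., vm). *)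
primrec iterated_frechet ::
    "('a::real_normed_vector \<Rightarrow> 'b::real_normed_vector) \<Rightarrow> 'a list \<Rightarrow> 'a \<Rightarrow> 'b" where
  "iterated_frechet F [] = F"
| "iterated_frechet F (v # vs) = (\<lambda>z. frechet_derivative (iterated_frechet F vs) (at z) v)"

definition frechet_power ::
    "nat \<Rightarrow> ('a::real_normed_vector \<Rightarrow> 'b::real_normed_vector) \<Rightarrow> 'a \<Rightarrow> 'a \<Rightarrow> 'b" where
  "frechet_power m F a z = iterated_frechet F (replicate m z) a"

definition starlike_maps ::
    "(complex ^ 'n) set \<Rightarrow> (complex ^ 'n \<Rightarrow> real) \<Rightarrow> (complex ^ 'n) set
      \<Rightarrow> (complex ^ 'n \<Rightarrow> complex ^ 'n) set" where
  "starlike_maps \<Omega> \<rho> E = {F.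
     holomorphic_map_on F \<Omega> \<and>
     F 0 = 0 \<and> complex_jacobian F 0 = mat 1 \<and>
     (\<forall>z\<in>\<Omega>. invertible (complex_jacobian F z)) \<and>
     (\<forall>z\<in>\<Omega> - E.
        Re (row_apply (wirtinger_row \<rho> z) (matrix_inv (complex_jacobian F z) *v F z)) > 0)}"

definition radial_coeff ::
    "(complex ^ 'n \<Rightarrow> real) \<Rightarrow> (complex ^ 'n \<Rightarrow> complex ^ 'n) \<Rightarrow> nat \<Rightarrow> complex ^ 'n \<Rightarrow> complex" where
  "radial_coeff \<rho> F m z =
     2 * row_apply (wirtinger_row \<rho> z) ((1 / (fact m * \<rho> z ^ m)) *\<^sub>R frechet_power m F 0 z)"

end

(* For F(z) = f(z) z one has DF(z)^{-1} F(z) = h(z) z with h = f / (f + Df(z) z), and Euler's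
   relation for the functional rho turns starlikeness into Re h > 0 off E. A countable union of
   lower-dimensional manifolds is meagre, so Re h >= 0 on the whole domain by continuity.

   Fix z off E, put phi(s) = f(s z), and restrict h to the disc of the s z, of radius 1 / rho(z):
   there h (phi + s phi') = phi. The three radial coefficients are b_1, b_2, b_3 divided by
   rho, rho^2, rho^3, where b_k are the Taylor coefficients of phi, and comparing coefficients
   gives b_1 b_2 - b_3 = (c_3 - 2 c_1 c_2) / 3 in terms of the coefficients c_k of h. Since
   Re h >= 0 and h(0) = 1, Livingston's inequality |c_3 - c_1 c_2| <= 2 (radius 1) and
   Caratheodory's |c_k| <= 2 give the bound (2 + 4) / 3 = 2. Working with h instead of 1 / h
   avoids showing that f has no zeros.

   Sharpness: f = (1 - L)^{-2} with a linear functional L, |L| <= rho, norming some boundary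
   point u; the expression has modulus 2 (|L(z)| / rho(z))^3, which is close to 2 near u / 2. *)

theory Submission
  imports Defs "HOL-Complex_Analysis.Complex_Analysis"
begin

subsection \<open>Lower-dimensional manifolds have empty interior\<close>

text \<open>Invariance of domain: a nonempty open set has no continuous injection into a subspace of
  smaller dimension, so \<open>g\<close> restricted to the interior of \<open>C\<close> would be
  contradictory.\<close>

lemma interior_homeomorphic_image_lower_dim:
  fixes C :: "'a::euclidean_space set" and T :: "'a set"
  assumes "subspace T" "dim T < DIM('a)" "continuous_on C g" "inj_on g C" "g ` C \<subseteq> T"
  shows "interior C = {}"
proof (rule ccontr)
  assume ne: "interior C \<noteq> {}"
  have "dim (UNIV :: 'a set) \<le> dim T"
  proof (rule invariance_of_dimension_subspaces[of UNIV "interior C" T g])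
    show "continuous_on (interior C) g" "inj_on g (interior C)" "g \<in> interior C \<rightarrow> T"
      using assms interior_subset[of C]
      by (auto intro: continuous_on_subset inj_on_subset)
  qed (use ne assms in auto)
  then show False
    using assms by simp
qed

text \<open>\<open>M\<close> need not be closed, and Baire's theorem wants closed sets. Each chart
  is therefore shrunk to a relatively open piece lying in a compact set with empty interior, and
  Lindelof's theorem leaves countably many such pieces.\<close>

lemma embedded_manifold_meagre:
  fixes M :: "'a::euclidean_space set"
  assumes M: "embedded_manifold k M" and k: "k < DIM('a)"
  obtains \<C> where "countable \<C>" "M \<subseteq> \<Union>\<C>" "\<And>C. C \<in> \<C> \<Longrightarrow> closed C \<and> interior C = {}"
proof -
  define \<U> where
    "\<U> = {U. openin (top_of_set M) U \<and> (\<exists>C. closed C \<and> interior C = {} \<and> U \<subseteq> C)}"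
  have chart: "\<exists>U\<in>\<U>. x \<in> U" if x: "x \<in> M" for x
  proof -
    obtain U T V where U: "openin (top_of_set M) U" "x \<in> U"
      and T: "subspace (T :: 'a set)" "dim T = k" and V: "openin (top_of_set T) V"
      and hom: "U homeomorphic V"
      using M x unfolding embedded_manifold_def by blast
    obtain g h where gh: "homeomorphism U V g h"
      using hom homeomorphic_def by blast
    have "g x \<in> V"
      using homeomorphism_image1[OF gh] U(2) by blast
    then obtain e where e: "e > 0" "cball (g x) e \<inter> T \<subseteq> V"
      using V unfolding openin_contains_cball by metis
    \<comment> \<open>Since \<open>K\<close> is compact, its image under \<open>h\<close> is closed
      in the whole space, which the chart domain \<open>U\<close> need not be. \<open>U'\<close> is
      the part of \<open>U\<close> that the open ball cuts out.\<close>
    define K where "K = cball (g x) e \<inter> T"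
    define U' where "U' = U \<inter> g -` ball (g x) e"
    have sub: "h ` K \<subseteq> U"
      using e(2) homeomorphism_image2[OF gh] unfolding K_def by blast
    have "compact (h ` K)"
    proof (rule compact_continuous_image)
      show "continuous_on K h"
        using continuous_on_subset[OF homeomorphism_cont2[OF gh]] e(2) unfolding K_def by blast
      show "compact K"
        unfolding K_def by (intro compact_Int_closed compact_cball closed_subspace T(1))
    qed
    moreover have "interior (h ` K) = {}"
    proof (rule interior_homeomorphic_image_lower_dim[OF T(1), where g = g])
      show "continuous_on (h ` K) g"
        using continuous_on_subset[OF homeomorphism_cont1[OF gh] sub] .
      show "inj_on g (h ` K)"
        using sub homeomorphism_apply1[OF gh] by (metis inj_on_inverseI subsetD)
      show "g ` h ` K \<subseteq> T"
        using sub homeomorphism_image1[OF gh] openin_imp_subset[OF V] by blast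
    qed (use k T in simp)
    moreover have "U' \<subseteq> h ` K"
    proof
      fix y assume y: "y \<in> U'"
      then have "g y \<in> V" "h (g y) = y"
        using homeomorphism_image1[OF gh] homeomorphism_apply1[OF gh] unfolding U'_def by auto
      moreover have "g y \<in> cball (g x) e"
        using y unfolding U'_def by auto
      ultimately show "y \<in> h ` K"
        using openin_imp_subset[OF V] unfolding K_def by (metis IntI image_eqI subsetD)
    qed
    moreover have "openin (top_of_set M) U'"
      unfolding U'_def using continuous_openin_preimage_gen[OF homeomorphism_cont1[OF gh] open_ball] U(1)
      by (rule openin_trans)
    ultimately have "U' \<in> \<U>"
      unfolding \<U>_def using compact_imp_closed by blast
    moreover have "x \<in> U'"
      using U(2) e(1) unfolding U'_def by simp
    ultimately show ?thesis
      by blast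
  qed
  obtain \<V> where \<V>: "\<V> \<subseteq> \<U>" "countable \<V>" "\<Union>\<V> = \<Union>\<U>"
    using Lindelof_openin[of \<U> M] unfolding \<U>_def by blast
  have "\<forall>U\<in>\<V>. \<exists>C. closed C \<and> interior C = {} \<and> U \<subseteq> C"
    using \<V>(1) unfolding \<U>_def by blast
  then obtain C where C: "\<And>U. U \<in> \<V> \<Longrightarrow> closed (C U) \<and> interior (C U) = {} \<and> U \<subseteq> C U"
    by metis
  show ?thesis
  proof (rule that[of "C ` \<V>"])
    show "countable (C ` \<V>)"
      using \<V>(2) by blast
    show "M \<subseteq> \<Union>(C ` \<V>)"
    proof
      fix x assume "x \<in> M"
      then obtain U where "U \<in> \<V>" "x \<in> U"
        using chart \<V>(3) by blast
      then show "x \<in> \<Union>(C ` \<V>)"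
        using C by blast
    qed
  qed (use C in blast)
qed

lemma interior_lower_dim_manifolds:
  fixes E :: "'a::euclidean_space set"
  assumes "consists_of_lower_dim_manifolds E"
  shows "interior E = {}"
proof -
  obtain \<M> where \<M>: "countable \<M>" "E = \<Union>\<M>" "\<forall>M\<in>\<M>. \<exists>k < DIM('a). embedded_manifold k M"
    using assms unfolding consists_of_lower_dim_manifolds_def by blast
  have "\<forall>M\<in>\<M>. \<exists>\<C>. countable \<C> \<and> M \<subseteq> \<Union>\<C> \<and> (\<forall>C\<in>\<C>. closed C \<and> interior C = {})"
    using \<M>(3) embedded_manifold_meagre by metis
  then obtain \<C> where \<C>: "\<And>M. M \<in> \<M> \<Longrightarrow> countable (\<C> M)" "\<And>M. M \<in> \<M> \<Longrightarrow> M \<subseteq> \<Union>(\<C> M)"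
    "\<And>M C. M \<in> \<M> \<Longrightarrow> C \<in> \<C> M \<Longrightarrow> closed C \<and> interior C = {}"
    by metis
  define \<G> where "\<G> = (\<Union>M\<in>\<M>. uminus ` \<C> M)"
  have "UNIV \<subseteq> closure (\<Inter>\<G>)"
  proof (rule Baire)
    show "countable \<G>"
      unfolding \<G>_def using \<M>(1) \<C>(1) by blast
    fix T assume "T \<in> \<G>"
    then show "openin (top_of_set UNIV) T \<and> UNIV \<subseteq> closure T"
      unfolding \<G>_def using \<C>(3) by (auto simp: closure_complement)
  qed simp
  moreover have "\<Inter>\<G> \<subseteq> - E"
    unfolding \<G>_def \<M>(2) using \<C>(2) by fastforce
  ultimately have "closure (- E) = UNIV"
    using closure_mono by blast
  then show ?thesis
    using closure_complement[of E] by auto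
qed

subsection \<open>Coefficients of functions with nonnegative real part\<close>

text \<open>Cauchy's formula with the circle parametrized by the unit interval: the scaled Taylor
  coefficient becomes a Fourier coefficient with respect to a probability measure.\<close>

lemma circle_coefficient:
  fixes f :: "complex \<Rightarrow> complex" and r R :: real
  assumes f: "f holomorphic_on ball 0 R" and r: "0 < r" "r < R"
  shows "((\<lambda>t. f (r * cis (2 * pi * t)) * cis (- (2 * pi * t)) ^ k)
          has_integral (r ^ k / fact k * (deriv ^^ k) f 0)) {0..1::real}"
proof -
  have "f holomorphic_on cball 0 r"
    using f r by (auto intro: holomorphic_on_subset)
  then have *: "((\<lambda>u. f u / (u - 0) ^ Suc k) has_contour_integral
      (2 * pi * \<i>) / fact k * (deriv ^^ k) f 0) (circlepath 0 r)"
    using r by (intro Cauchy_has_contour_integral_higher_derivative_circlepath)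
      (auto intro: holomorphic_on_imp_continuous_on holomorphic_on_subset)
  have e: "exp (2 * complex_of_real pi * \<i> * complex_of_real t) = cis (2 * pi * t)" for t
    by (simp add: cis_conv_exp mult_ac)
  have "((\<lambda>t. f (r * cis (2 * pi * t)) / (r * cis (2 * pi * t)) ^ Suc k *
      (2 * pi * \<i> * r * cis (2 * pi * t)))
      has_integral (2 * pi * \<i>) / fact k * (deriv ^^ k) f 0) {0..1::real}"
    using * unfolding has_contour_integral vector_derivative_circlepath unfolding circlepath
    by (simp add: e)
  from has_integral_mult_right[OF this, of "r ^ k / (2 * pi * \<i>)"]
  have "((\<lambda>t. r ^ k / (2 * pi * \<i>) * (f (r * cis (2 * pi * t)) / (r * cis (2 * pi * t)) ^ Suc k *
      (2 * pi * \<i> * r * cis (2 * pi * t))))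
      has_integral r ^ k / fact k * (deriv ^^ k) f 0) {0..1::real}"
    by (simp add: field_simps)
  moreover have "r ^ k / (2 * pi * \<i>) * (f w / (r * cis s) ^ Suc k * (2 * pi * \<i> * r * cis s))
      = f w * cis (- s) ^ k" for s w
    using r by (simp add: field_simps power_mult_distrib flip: cis_inverse)
  ultimately show ?thesis
    by simp
qed

text \<open>
  With respect to the probability density \<open>Re h\<close> on the circle of radius \<open>r\<close>, the coefficient \<open>c k\<close> is
  twice the \<open>k\<close>-th moment. Hence \<open>(c (k + l) - c k * c l) / 2\<close> is the integral of
  \<open>x ^ k * (x ^ l - c l)\<close>, and the mean square of \<open>x ^ l - c l\<close> is exactly 1.
\<close>
lemma caratheodory_bounds:
  fixes h :: "complex \<Rightarrow> complex" and r R :: real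
  assumes h: "h holomorphic_on ball 0 R" and h0: "h 0 = 1"
    and pos: "\<And>w. w \<in> ball 0 R \<Longrightarrow> Re (h w) \<ge> 0" and r: "0 < r" "r < R"
  defines "c \<equiv> \<lambda>k. r ^ k / fact k * (deriv ^^ k) h 0"
  assumes k: "k \<ge> 1" and l: "l \<ge> 1"
  shows "cmod (c k) \<le> 2" and "cmod (c (k + l) - c k * c l) \<le> 2"
proof -
  define e where "e t = cis (2 * pi * t)" for t :: real
  define x where "x t = cnj (e t)" for t
  define u where "u t = Re (h (r * e t))" for t
  have ne: "norm (e t) = 1" and xe: "cis (- (2 * pi * t)) = x t" for t
    by (simp_all add: e_def x_def cis_cnj)
  have u0: "u t \<ge> 0" for t
    unfolding u_def using r by (intro pos) (simp add: norm_mult ne)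
  have I1: "((\<lambda>t. h (r * e t) * x t ^ j) has_integral c j) {0..1}" for j
    using circle_coefficient[OF h r, of j] unfolding xe by (simp add: e_def c_def)
  \<comment> \<open>The function \<open>h w * w ^ j\<close> is holomorphic and vanishes at 0, so its
    mean over the circle is 0.\<close>
  have I2: "((\<lambda>t. h (r * e t) * e t ^ j) has_integral 0) {0..1}" if "j \<ge> 1" for j
  proof -
    have "(\<lambda>w. h w * w ^ j) holomorphic_on ball 0 R"
      using h by (intro holomorphic_intros)
    from circle_coefficient[OF this r, of 0]
    have "((\<lambda>t. h (r * e t) * (r * e t) ^ j) has_integral 0) {0..1}"
      using that by (simp add: e_def power_0_left)
    from has_integral_mult_right[OF this, of "1 / r ^ j"] show ?thesis
      using r by (simp add: power_mult_distrib field_simps)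
  qed
  \<comment> \<open>\<open>u\<close> is half the sum of \<open>h\<close> and its conjugate. The
    conjugate half integrates to 0 by \<open>I2\<close>, which is where the factor 1/2 comes
    from.\<close>
  have Iu: "((\<lambda>t. u t * x t ^ j) has_integral c j / 2) {0..1}" if "j \<ge> 1" for j
  proof -
    have "((\<lambda>t. cnj (h (r * e t) * e t ^ j)) has_integral 0) {0..1}"
      using has_integral_cnj[of "\<lambda>t. h (r * e t) * e t ^ j" 0] I2[OF that] by (simp add: o_def)
    from has_integral_mult_right[OF has_integral_add[OF I1[of j] this], of "1/2"]
    show ?thesis
      by (simp add: u_def x_def complex_add_cnj flip: distrib_right of_real_mult)
        (simp add: field_simps complex_eq_iff)
  qed
  have Iu0: "(u has_integral 1) {0..1}"
    using has_integral_linear[OF I1[of 0] bounded_linear_Re] by (simp add: u_def[abs_def] o_def c_def h0)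
  have "cmod (c k / 2) \<le> (1::real) \<bullet> 1"
    by (rule has_integral_norm_bound_integral_component[OF Iu[OF k] Iu0])
      (simp add: norm_mult norm_power x_def ne u0)
  then show "cmod (c k) \<le> 2"
    by (simp add: norm_divide)
  define M where "M = c l"
  have J: "((\<lambda>t. u t * x t ^ k * (x t ^ l - M)) has_integral (c (k + l) - c k * c l) / 2) {0..1}"
    using has_integral_diff[OF Iu[of "k + l"] has_integral_mult_left[OF Iu[OF k], of M]] k
    by (simp add: algebra_simps power_add M_def diff_divide_distrib)
  have "((\<lambda>t. Re (cnj M * (u t * x t ^ l))) has_integral Re (cnj M * (c l / 2))) {0..1}"
    using has_integral_linear[OF has_integral_mult_right[OF Iu[OF l], of "cnj M"] bounded_linear_Re]
    by (simp add: o_def)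
  \<comment> \<open>The integrand is \<open>u\<close> times (1 + |x^l - M|^2) / 2, expanded with |x|
    = 1; its integral is 1 because the two |M|^2 terms cancel.\<close>
  then have I: "((\<lambda>t. (u t * (2 + (cmod M)\<^sup>2) - 2 * Re (cnj M * (u t * x t ^ l))) / 2) has_integral
      (1 * (2 + (cmod M)\<^sup>2) - 2 * Re (cnj M * (c l / 2))) / 2) {0..1}"
    by (intro has_integral_divide has_integral_diff has_integral_mult_left[OF Iu0] has_integral_mult_right)
  have reM: "Re (cnj M * (c l / 2)) = (cmod M)\<^sup>2 / 2"
    by (simp add: M_def cmod_power2) (simp add: power2_eq_square)
  have one: "(1 * (2 + (cmod M)\<^sup>2) - 2 * Re (cnj M * (c l / 2))) / 2 = 1"
    unfolding reM by (simp add: field_simps)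
  have G: "((\<lambda>t. (u t * (2 + (cmod M)\<^sup>2) - 2 * Re (cnj M * (u t * x t ^ l))) / 2)
      has_integral 1) {0..1}"
    using I unfolding one .
  have JG: "norm (u t * x t ^ k * (x t ^ l - M)) \<le>
      (u t * (2 + (cmod M)\<^sup>2) - 2 * Re (cnj M * (u t * x t ^ l))) / 2" for t
  proof -
    define y where "y = x t ^ l"
    have "cmod y = 1"
      by (simp add: y_def norm_power x_def ne)
    then have y: "(Re y)\<^sup>2 + (Im y)\<^sup>2 = 1"
      by (metis cmod_power2 one_power2)
    have "(cmod (y - M))\<^sup>2 = 1 + (cmod M)\<^sup>2 - 2 * Re (cnj M * y)"
      using y unfolding cmod_power2 by (simp add: power2_eq_square algebra_simps)
    moreover \<comment> \<open>AM-GM in place of Cauchy--Schwarz\<close>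
    have "2 * cmod (y - M) \<le> 1 + (cmod (y - M))\<^sup>2"
      using sum_power2_ge_zero[of "cmod (y - M) - 1" 0] by (simp add: power2_eq_square algebra_simps)
    ultimately have "cmod (y - M) \<le> (2 + (cmod M)\<^sup>2 - 2 * Re (cnj M * y)) / 2"
      by simp
    from mult_left_mono[OF this u0[of t]]
    have "u t * cmod (y - M) \<le> (u t * (2 + (cmod M)\<^sup>2) - 2 * Re (cnj M * (u t * y))) / 2"
      by (simp add: algebra_simps)
    moreover have "norm (u t * x t ^ k * (x t ^ l - M)) = u t * cmod (y - M)"
      using u0[of t] by (simp add: norm_mult norm_power x_def ne y_def)
    ultimately show ?thesis
      by (simp add: y_def)
  qed
  have "cmod ((c (k + l) - c k * c l) / 2) \<le> (1::real) \<bullet> 1"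
    by (rule has_integral_norm_bound_integral_component[OF J G]) (simp only: JG inner_real_def mult_1_right)
  then show "cmod (c (k + l) - c k * c l) \<le> 2"
    by (simp add: norm_divide)
qed

subsection \<open>Holomorphic functions of several variables\<close>

lemma norm_vector_scale: "norm (c *s v) = cmod c * norm (v :: complex ^ 'n)"
  by (simp add: norm_vec_def norm_mult L2_set_right_distrib)

text \<open>Supplies the product rule and the continuity rules for complex scalar multiplication of
  vectors.\<close>

interpretation vec_scale: bounded_bilinear "(*s) :: complex \<Rightarrow> complex ^ 'n \<Rightarrow> complex ^ 'n"
proof
  show "\<exists>K. \<forall>a b. norm (a *s b) \<le> norm a * norm (b :: complex ^ 'n) * K"
    by (intro exI[of _ 1]) (simp add: norm_vector_scale)
qed (vector algebra_simps scaleR_conv_of_real)+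

lemma linear_scale_mult_iff:
  "Vector_Spaces.linear (*s) (*) (D :: complex ^ 'n \<Rightarrow> complex) \<longleftrightarrow>
    (\<forall>x y. D (x + y) = D x + D y) \<and> (\<forall>c x. D (c *s x) = c * D x)"
  using Vector_Spaces.linear_iff[of "(*s)" "(*)" D]
  by (simp add: vec.vector_space_axioms vector_space_over_itself.vector_space_axioms)

lemma holomorphic_fun_onD:
  assumes "holomorphic_fun_on u S" "z \<in> S"
  shows "(u has_derivative frechet_derivative u (at z)) (at z)"
    and "frechet_derivative u (at z) (c *s v) = c * frechet_derivative u (at z) v"
proof -
  obtain D where D: "(u has_derivative D) (at z)" "Vector_Spaces.linear (*s) (*) D"
    using assms unfolding holomorphic_fun_on_def by blast
  have "frechet_derivative u (at z) = D"
    using D(1) frechet_derivative_at by metis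
  then show "(u has_derivative frechet_derivative u (at z)) (at z)"
    "frechet_derivative u (at z) (c *s v) = c * frechet_derivative u (at z) v"
    using D unfolding linear_scale_mult_iff by blast+
qed

lemma linear_scale_vec_iff:
  "Vector_Spaces.linear (*s) (*s) (D :: complex ^ 'n \<Rightarrow> complex ^ 'n) \<longleftrightarrow>
    (\<forall>x y. D (x + y) = D x + D y) \<and> (\<forall>c x. D (c *s x) = c *s D x)"
  using Vector_Spaces.linear_iff[of "(*s)" "(*s)" D]
  by (simp add: vec.vector_space_axioms)

section \<open>Restriction to complex lines and Cauchy's formula there\<close>

lemma holomorphic_fun_on_line:
  assumes "holomorphic_fun_on u S" "w + \<zeta> *s v \<in> S"
  shows "((\<lambda>\<zeta>. u (w + \<zeta> *s v)) has_field_derivative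
          frechet_derivative u (at (w + \<zeta> *s v)) v) (at \<zeta>)"
proof -
  have "((\<lambda>\<zeta>. w + \<zeta> *s v) has_derivative (\<lambda>h. h *s v)) (at \<zeta>)"
    using has_derivative_add[OF has_derivative_const
        bounded_linear_imp_has_derivative[OF vec_scale.bounded_linear_left]] by simp
  from diff_chain_at[OF this holomorphic_fun_onD(1)[OF assms]] show ?thesis
    by (simp add: has_field_derivative_def o_def holomorphic_fun_onD(2)[OF assms] mult.commute[of _ "_ v"])
qed

lemma holomorphic_fun_on_continuous:
  "holomorphic_fun_on u S \<Longrightarrow> continuous_on S u"
  by (meson holomorphic_fun_onD(1) has_derivative_continuous continuous_at_imp_continuous_on)

text \<open>Expresses a directional derivative through values of \<open>u\<close> alone, on a circle
  that is translated along with \<open>w\<close>. Regularity in \<open>w\<close> can then be read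
  off under the integral sign.\<close>

lemma frechet_derivative_circle:
  fixes r R :: real
  assumes u: "holomorphic_fun_on u S" and r: "0 < r" "r < R"
    and sub: "\<And>\<zeta>. \<zeta> \<in> ball 0 R \<Longrightarrow> w + \<zeta> *s v \<in> S"
  shows "frechet_derivative u (at w) v =
    integral (cbox 0 1) (\<lambda>t. cis (- (2 * pi * t)) / r * u (w + (r * cis (2 * pi * t)) *s v))"
proof -
  define g where "g \<zeta> = u (w + \<zeta> *s v)" for \<zeta>
  have g': "(g has_field_derivative frechet_derivative u (at (w + \<zeta> *s v)) v) (at \<zeta>)"
    if "\<zeta> \<in> ball 0 R" for \<zeta>
    unfolding g_def using holomorphic_fun_on_line[OF u sub[OF that]] .
  have "g holomorphic_on ball 0 R"
    using g' by (meson holomorphic_on_open open_ball)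
  from has_integral_mult_right[OF circle_coefficient[OF this r, of 1], of "1 / r"]
  have "((\<lambda>t. cis (- (2 * pi * t)) / r * g (r * cis (2 * pi * t))) has_integral deriv g 0) (cbox 0 1)"
    using r by (simp add: mult_ac)
  moreover have "deriv g 0 = frechet_derivative u (at w) v"
    using g'[of 0] r by (simp add: DERIV_imp_deriv)
  ultimately show ?thesis
    unfolding g_def by (simp add: has_integral_iff)
qed

text \<open>One radius has to serve all base points near \<open>w0\<close>, so that the integral
  formula holds on a whole neighbourhood with a fixed circle.\<close>

lemma local_circle:
  fixes v :: "complex ^ 'n"
  assumes "open S" "w0 \<in> S"
  obtains e r :: real where "e > 0" "r > 0" "ball w0 e \<subseteq> S"
    "\<And>w \<zeta>. w \<in> ball w0 e \<Longrightarrow> \<zeta> \<in> ball 0 (2 * r) \<Longrightarrow> w + \<zeta> *s v \<in> S"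
proof -
  obtain d where d: "d > 0" "ball w0 d \<subseteq> S"
    using assms openE by blast
  \<comment> \<open>The summand 1 keeps the denominator positive when \<open>v = 0\<close>.\<close>
  define r where "r = d / 4 / (norm v + 1)"
  have nv: "norm v + 1 > 0"
    by (simp add: add_nonneg_pos)
  have r: "r > 0"
    unfolding r_def using d nv by simp
  have rv: "2 * r * norm v \<le> d / 2"
  proof -
    have "2 * r * norm v \<le> 2 * r * (norm v + 1)"
      using r by simp
    also have "\<dots> = d / 2"
      using nv by (simp add: r_def field_simps)
    finally show ?thesis .
  qed
  show ?thesis
  proof (rule that[of "d / 2" r])
    show "ball w0 (d / 2) \<subseteq> S"
      using d by (auto simp: subset_iff)
    fix w and \<zeta> :: complex assume w: "w \<in> ball w0 (d / 2)" and z: "\<zeta> \<in> ball 0 (2 * r)"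
    have "norm (\<zeta> *s v) \<le> 2 * r * norm v"
      using z by (simp add: norm_vector_scale mult_right_mono)
    then have "dist w (w + \<zeta> *s v) \<le> d / 2"
      using rv by (simp add: dist_norm)
    moreover have "dist w0 w < d / 2"
      using w by simp
    ultimately have "w + \<zeta> *s v \<in> ball w0 d"
      using dist_triangle[of w0 "w + \<zeta> *s v" w] by simp
    then show "w + \<zeta> *s v \<in> S"
      using d by blast
  qed (use d r in auto)
qed

lemma continuous_on_frechet_derivative:
  assumes "open S" and u: "holomorphic_fun_on u S"
  shows "continuous_on S (\<lambda>w. frechet_derivative u (at w) v)"
proof -
  have "isCont (\<lambda>w. frechet_derivative u (at w) v) w0" if w0: "w0 \<in> S" for w0
  proof -
    obtain e r where er: "e > 0" "r > 0" "ball w0 e \<subseteq> S"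
      "\<And>w \<zeta>. w \<in> ball w0 e \<Longrightarrow> \<zeta> \<in> ball 0 (2 * r) \<Longrightarrow> w + \<zeta> *s v \<in> S"
      using local_circle[OF assms(1) w0, of v] by metis
    have "continuous_on (ball w0 e) (\<lambda>w. integral (cbox 0 1)
        (\<lambda>t. cis (- (2 * pi * t)) / r * u (w + (r * cis (2 * pi * t)) *s v)))"
      by (rule integral_continuous_on_param)
        (use er in \<open>auto intro!: continuous_intros vec_scale.continuous_on norm_mult_less
          continuous_on_compose2[OF holomorphic_fun_on_continuous[OF u]] simp: split_beta norm_mult\<close>)
    then have "continuous_on (ball w0 e) (\<lambda>w. frechet_derivative u (at w) v)"
      using frechet_derivative_circle[OF u er(2), of "2 * r"] er
      by (elim continuous_on_eq) auto
    then show ?thesis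
      using er(1) by (simp add: continuous_on_eq_continuous_at)
  qed
  then show ?thesis
    by (simp add: continuous_at_imp_continuous_on)
qed

text \<open>Holomorphy is defined by mere differentiability, so smoothness must be earned. The
  Cauchy integral for the derivative is differentiated under the integral sign, and complex
  linearity passes from the integrand to the integral.\<close>

lemma holomorphic_fun_on_frechet_derivative:
  assumes "open S" and u: "holomorphic_fun_on u S"
  shows "holomorphic_fun_on (\<lambda>w. frechet_derivative u (at w) v) S"
  unfolding holomorphic_fun_on_def
proof
  fix w0 assume w0: "w0 \<in> S"
  obtain e r where er: "e > 0" "r > 0" "ball w0 e \<subseteq> S"
    "\<And>w \<zeta>. w \<in> ball w0 e \<Longrightarrow> \<zeta> \<in> ball 0 (2 * r) \<Longrightarrow> w + \<zeta> *s v \<in> S"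
    using local_circle[OF assms(1) w0, of v] by metis
  \<comment> \<open>The Leibniz rule asks for an operator-valued derivative that is continuous in
    norm. In finite dimension this follows from the continuity of the directional derivatives.
    \<open>Blinfun\<close> is meaningful only at points of \<open>S\<close>.\<close>
  define u' where "u' w = Blinfun (frechet_derivative u (at w))" for w
  have u': "blinfun_apply (u' w) = frechet_derivative u (at w)" if "w \<in> S" for w
    unfolding u'_def using holomorphic_fun_onD(1)[OF u that]
    by (intro bounded_linear_Blinfun_apply has_derivative_bounded_linear)
  have cont': "continuous_on S u'"
    using continuous_on_frechet_derivative[OF assms]
    by (intro continuous_on_blinfun_componentwise) (auto simp: u' cong: continuous_on_cong)
  define a where "a t = r * cis (2 * pi * t)" for t :: real
  define b where "b t = cis (- (2 * pi * t)) / r" for t :: real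
  have inS: "w + a t *s v \<in> S" if "w \<in> ball w0 e" for w t
    using er that by (auto simp: a_def norm_mult)
  have ca: "continuous_on X (\<lambda>x. a (g x))" "continuous_on X (\<lambda>x. b (g x))"
    if "continuous_on X g" for X :: "((complex ^ 'a) \<times> real) set" and g
    unfolding a_def b_def using er(2) by (auto intro!: continuous_intros that)
  have ca': "continuous_on X a" "continuous_on X b" for X
    unfolding a_def b_def using er(2) by (auto intro!: continuous_intros)
  define f' where "f' w t = blinfun_mult_right (b t) o\<^sub>L u' (w + a t *s v)" for w t
  have f'_apply: "f' w t h = b t * frechet_derivative u (at (w + a t *s v)) h"
    if "w \<in> ball w0 e" for w t h
    unfolding f'_def using u'[OF inS[OF that]] by simp
  have der: "((\<lambda>w. integral (cbox 0 1) (\<lambda>t. b t * u (w + a t *s v))) has_derivative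
      integral (cbox 0 1) (f' w0)) (at w0 within ball w0 e)"
  proof (rule leibniz_rule)
    fix w and t :: real assume w: "w \<in> ball w0 e"
    have "((\<lambda>w. w + a t *s v) has_derivative (\<lambda>h. h)) (at w)"
      by (auto intro!: derivative_eq_intros)
    from diff_chain_at[OF this holomorphic_fun_onD(1)[OF u inS[OF w]]]
    have "((\<lambda>w. b t * u (w + a t *s v)) has_derivative f' w t) (at w)"
      using f'_apply[OF w] by (auto intro!: derivative_eq_intros simp: o_def)
    then show "((\<lambda>w. b t * u (w + a t *s v)) has_derivative f' w t) (at w within ball w0 e)"
      by (rule has_derivative_at_withinI)
  next
    fix w assume w: "w \<in> ball w0 e"
    show "(\<lambda>t. b t * u (w + a t *s v)) integrable_on cbox 0 1"
      by (intro integrable_continuous continuous_intros vec_scale.continuous_on ca'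
          continuous_on_compose2[OF holomorphic_fun_on_continuous[OF u]]) (use inS[OF w] in auto)
  next
    show "continuous_on (ball w0 e \<times> cbox 0 1) (\<lambda>(w, t). f' w t)"
      unfolding f'_def split_beta
      by (intro continuous_intros vec_scale.continuous_on ca
          continuous_on_compose2[OF cont']
          bounded_linear.continuous_on[OF bounded_linear_blinfun_mult_right]) (use inS in auto)
  qed (use er in auto)
  define D where "D = blinfun_apply (integral (cbox 0 1) (f' w0))"
  have "continuous_on (cbox 0 1) (f' w0)"
    unfolding f'_def
    by (intro continuous_intros vec_scale.continuous_on ca'
        continuous_on_compose2[OF cont']
        bounded_linear.continuous_on[OF bounded_linear_blinfun_mult_right]) (use inS er in auto)
  then have int: "f' w0 integrable_on cbox 0 1"
    by (rule integrable_continuous)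
  have D: "D h = integral (cbox 0 1) (\<lambda>t. b t * frechet_derivative u (at (w0 + a t *s v)) h)" for h
    unfolding D_def blinfun_apply_integral[OF int] using er by (simp add: f'_apply)
  have "((\<lambda>w. frechet_derivative u (at w) v) has_derivative D) (at w0)"
  proof (rule has_derivative_transform_within_open[of _ _ _ UNIV "ball w0 e"])
    show "((\<lambda>w. integral (cbox 0 1) (\<lambda>t. b t * u (w + a t *s v))) has_derivative D) (at w0)"
      using der er at_within_open[of w0 "ball w0 e"] by (simp add: D_def)
    fix w assume "w \<in> ball w0 e"
    then show "integral (cbox 0 1) (\<lambda>t. b t * u (w + a t *s v)) = frechet_derivative u (at w) v"
      using frechet_derivative_circle[OF u er(2), of "2 * r" w v] er
      by (simp add: a_def b_def)
  qed (use er in auto)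
  moreover have "Vector_Spaces.linear (*s) (*) D"
    unfolding linear_scale_mult_iff
  proof (intro conjI allI)
    show "D (x + y) = D x + D y" for x y
      by (simp add: D_def blinfun.add_right)
    show "D (c *s x) = c * D x" for c x
    proof -
      have "D (c *s x) = integral (cbox 0 1) (\<lambda>t. c * (b t * frechet_derivative u (at (w0 + a t *s v)) x))"
        unfolding D using inS er by (intro integral_cong) (simp add: holomorphic_fun_onD(2)[OF u])
      then show ?thesis
        unfolding D by simp
    qed
  qed
  ultimately show "\<exists>D. ((\<lambda>w. frechet_derivative u (at w) v) has_derivative D) (at w0) \<and>
      Vector_Spaces.linear (*s) (*) D"
    by blast
qed

section \<open>Iterated derivatives, by coordinates and along lines\<close>

lemma has_derivative_vec_componentwise:
  fixes G :: "'a::real_normed_vector \<Rightarrow> complex ^ 'n"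
  assumes "\<And>j. ((\<lambda>x. G x $ j) has_derivative (\<lambda>h. D h $ j)) (at x)"
  shows "(G has_derivative D) (at x)"
  unfolding has_derivative_componentwise_within[of G]
  by (auto simp: Basis_vec_def inner_axis intro!: has_derivative_inner_left assms)

lemma holomorphic_fun_on_iterated_frechet:
  "open S \<Longrightarrow> holomorphic_fun_on u S \<Longrightarrow> holomorphic_fun_on (iterated_frechet u vs) S"
  by (induction vs) (simp_all add: holomorphic_fun_on_frechet_derivative)

lemma frechet_derivative_transform_within_open:
  assumes "(G has_derivative D) (at x)" "open S" "x \<in> S" "\<And>y. y \<in> S \<Longrightarrow> G y = G' y"
  shows "frechet_derivative G' (at x) = D"
  using has_derivative_transform_within_open[OF assms] frechet_derivative_at by metis

text \<open>Reduces the derivatives of a vector-valued map to the scalar theory.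
  \<open>frechet_derivative\<close> commutes with taking a coordinate only where the derivative
  exists, and holomorphy of the coordinates guarantees this at every order.\<close>

lemma iterated_frechet_component:
  fixes F :: "complex ^ 'n \<Rightarrow> complex ^ 'm"
  assumes S: "open S" and F: "\<And>j. holomorphic_fun_on (\<lambda>w. F w $ j) S" and "w \<in> S"
  shows "iterated_frechet F vs w $ j = iterated_frechet (\<lambda>w. F w $ j) vs w"
  using \<open>w \<in> S\<close>
proof (induction vs arbitrary: w j)
  case (Cons v vs)
  define G where "G x = (\<chi> j. iterated_frechet (\<lambda>w. F w $ j) vs x)" for x
  define D where "D h = (\<chi> j. frechet_derivative (iterated_frechet (\<lambda>w. F w $ j) vs) (at w) h)" for h
  have "(G has_derivative D) (at w)"
    using holomorphic_fun_onD(1)[OF holomorphic_fun_on_iterated_frechet[OF S F] Cons.prems]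
    by (intro has_derivative_vec_componentwise) (simp add: G_def D_def)
  then have "frechet_derivative (iterated_frechet F vs) (at w) = D"
    by (rule frechet_derivative_transform_within_open[OF _ S Cons.prems])
      (simp add: G_def vec_eq_iff Cons.IH)
  then show ?case
    by (simp add: D_def)
qed simp

lemma open_line_preimage:
  fixes z :: "complex ^ 'n"
  assumes "open S"
  shows "open {\<zeta>. \<zeta> *s z \<in> S}"
proof -
  have "continuous_on UNIV (\<lambda>\<zeta>. \<zeta> *s z)"
    by (intro vec_scale.continuous_on continuous_intros)
  from open_vimage[OF assms this] show ?thesis
    by (simp add: vimage_def)
qed

text \<open>Only \<zeta> = 0 is of interest later, but the induction differentiates in \<zeta> and
  so needs the identity on an open set.\<close>

lemma iterated_frechet_line:
  assumes S: "open S" and u: "holomorphic_fun_on u S" and "\<zeta> *s z \<in> S"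
  shows "iterated_frechet u (replicate m z) (\<zeta> *s z) = (deriv ^^ m) (\<lambda>\<zeta>. u (\<zeta> *s z)) \<zeta>"
  using \<open>\<zeta> *s z \<in> S\<close>
proof (induction m arbitrary: \<zeta>)
  case (Suc m)
  define G where "G = iterated_frechet u (replicate m z)"
  have "((\<lambda>\<zeta>. G (0 + \<zeta> *s z)) has_field_derivative frechet_derivative G (at (0 + \<zeta> *s z)) z) (at \<zeta>)"
    unfolding G_def using Suc.prems
    by (intro holomorphic_fun_on_line[OF holomorphic_fun_on_iterated_frechet[OF S u]]) simp
  then have "((\<lambda>\<zeta>. G (\<zeta> *s z)) has_field_derivative frechet_derivative G (at (\<zeta> *s z)) z) (at \<zeta>)"
    by simp
  then have "((deriv ^^ m) (\<lambda>\<zeta>. u (\<zeta> *s z)) has_field_derivative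
      frechet_derivative G (at (\<zeta> *s z)) z) (at \<zeta>)"
    by (rule has_field_derivative_transform_within_open[OF _ open_line_preimage[OF S, of z]])
      (use Suc in \<open>simp_all add: G_def\<close>)
  then show ?case
    by (simp add: G_def DERIV_imp_deriv)
qed simp

subsection \<open>Maps of the form f(z) z and the Minkowski functional\<close>

lemma has_derivative_scale_self:
  assumes "open S" "holomorphic_fun_on f S" "\<And>w. w \<in> S \<Longrightarrow> F w = f w *s w" "z \<in> S"
  shows "(F has_derivative (\<lambda>h. f z *s h + frechet_derivative f (at z) h *s z)) (at z)"
proof (rule has_derivative_transform_within_open[OF _ assms(1,4)])
  show "((\<lambda>w. f w *s w) has_derivative (\<lambda>h. f z *s h + frechet_derivative f (at z) h *s z)) (at z)"
    using vec_scale.FDERIV[OF holomorphic_fun_onD(1)[OF assms(2,4)] has_derivative_ident] .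
qed (simp add: assms(3))

lemma linear_scale_self:
  assumes "holomorphic_fun_on f S" "z \<in> S"
  shows "Vector_Spaces.linear (*s) (*s) (\<lambda>h. f z *s h + frechet_derivative f (at z) h *s z)"
  unfolding linear_scale_vec_iff
  using holomorphic_fun_onD(2)[OF assms]
    has_derivative_bounded_linear[OF holomorphic_fun_onD(1)[OF assms]]
  by (auto simp: linear_simps(1) vec_eq_iff algebra_simps)

lemma complex_jacobian_scale_self:
  assumes "open S" "holomorphic_fun_on f S" "\<And>w. w \<in> S \<Longrightarrow> F w = f w *s w" "z \<in> S"
  shows "complex_jacobian F z *v h = f z *s h + frechet_derivative f (at z) h *s z"
proof -
  have "frechet_derivative F (at z) = (\<lambda>h. f z *s h + frechet_derivative f (at z) h *s z)"
    using has_derivative_scale_self[OF assms] frechet_derivative_at by metis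
  then show ?thesis
    unfolding complex_jacobian_def using linear_scale_self[OF assms(2,4)] by (simp add: matrix_works)
qed

text \<open>The Jacobian is \<open>f z\<close> times the identity plus a rank-one map with values in
  the line of \<open>z\<close>. Hence \<open>z\<close> is an eigenvector with eigenvalue
  \<open>f z + D z\<close>, and for nonzero \<open>f z\<close> every kernel vector is a multiple of
  \<open>z\<close>.\<close>

lemma invertible_jacobian_scale_self:
  assumes S: "open S" and f: "holomorphic_fun_on f S" and F: "\<And>w. w \<in> S \<Longrightarrow> F w = f w *s w"
    and z: "z \<in> S"
  defines "D \<equiv> frechet_derivative f (at z)"
  shows "invertible (complex_jacobian F z) \<Longrightarrow> z \<noteq> 0 \<Longrightarrow> f z + D z \<noteq> 0"
    and "f z \<noteq> 0 \<Longrightarrow> f z + D z \<noteq> 0 \<Longrightarrow> invertible (complex_jacobian F z)"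
proof -
  note J = complex_jacobian_scale_self[OF S f F z, folded D_def]
  have Jz: "complex_jacobian F z *v z = (f z + D z) *s z"
    by (simp add: J vec.scale_left_distrib)
  have inv: "invertible (complex_jacobian F z) \<longleftrightarrow> (\<forall>h. complex_jacobian F z *v h = 0 \<longrightarrow> h = 0)"
    by (simp add: invertible_left_inverse matrix_left_invertible_ker)
  show "invertible (complex_jacobian F z) \<Longrightarrow> z \<noteq> 0 \<Longrightarrow> f z + D z \<noteq> 0"
    using Jz inv by force
  assume f: "f z \<noteq> 0" and q: "f z + D z \<noteq> 0"
  show "invertible (complex_jacobian F z)"
    unfolding inv
  proof (intro allI impI)
    fix h assume "complex_jacobian F z *v h = 0"
    then have "f z *s h = - (D h *s z)"
      by (simp add: J eq_neg_iff_add_eq_0)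
    then have "h = (1 / f z) *s (- (D h *s z))"
      using f by (metis (no_types, lifting) nonzero_eq_divide_eq vec.scale_one vector_smult_assoc)
    then have h: "h = (- D h / f z) *s z"
      by (simp add: vec_eq_iff)
    define s where "s = - D h / f z"
    have "s *s ((f z + D z) *s z) = 0"
      using \<open>complex_jacobian F z *v h = 0\<close> h
      by (metis Jz s_def vector_scalar_commute vec.scale)
    then have "s = 0 \<or> z = 0"
      using q by (metis vec.scale_eq_0_iff)
    then show "h = 0"
      using h s_def by auto
  qed
qed

text \<open>\<open>F z\<close> is a multiple of the eigenvector \<open>z\<close>, so the inverse
  Jacobian only divides it by the eigenvalue.\<close>

lemma matrix_inv_jacobian_scale_self:
  assumes S: "open S" and f: "holomorphic_fun_on f S" and F: "\<And>w. w \<in> S \<Longrightarrow> F w = f w *s w"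
    and z: "z \<in> S"
  defines "D \<equiv> frechet_derivative f (at z)"
  assumes inv: "invertible (complex_jacobian F z)" and q: "f z + D z \<noteq> 0"
  shows "matrix_inv (complex_jacobian F z) *v F z = (f z / (f z + D z)) *s z"
proof -
  note J = complex_jacobian_scale_self[OF S f F z, folded D_def]
    and D = holomorphic_fun_onD(2)[OF f z, folded D_def]
  define c where "c = f z / (f z + D z)"
  have "complex_jacobian F z *v (c *s z) = (c * (f z + D z)) *s z"
    by (simp add: J D vec_eq_iff algebra_simps)
  also have "\<dots> = F z"
    using q by (simp add: c_def F[OF z])
  finally have "matrix_inv (complex_jacobian F z) *v F z =
      (matrix_inv (complex_jacobian F z) ** complex_jacobian F z) *v (c *s z)"
    by (simp add: matrix_vector_mul_assoc[symmetric])
  then show ?thesis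
    using someI_ex[OF inv[unfolded invertible_def]] by (simp add: c_def matrix_inv_def)
qed

section \<open>Wirtinger derivatives and homogeneity of the Minkowski functional\<close>

lemma directional_derivative:
  fixes \<rho> :: "'a::real_normed_vector \<Rightarrow> real"
  assumes D: "(\<rho> has_derivative D) (at z)"
  shows "((\<lambda>t. \<rho> (z + t *\<^sub>R w)) has_real_derivative D w) (at 0)"
proof -
  have "((\<lambda>t. z + t *\<^sub>R w) has_derivative (\<lambda>t. t *\<^sub>R w)) (at 0)"
    by (auto intro!: derivative_eq_intros)
  from diff_chain_at[OF this, of \<rho> D] D show ?thesis
    using linear_simps(5)[OF has_derivative_bounded_linear[OF D]]
    by (simp add: o_def has_field_derivative_def mult.commute[of _ "D _"])
qed

lemma row_apply_scale: "row_apply r (c *s v) = c * row_apply r v"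
  by (simp add: row_apply_def sum_distrib_left mult_ac)

text \<open>The right-hand side is the complex-linear part of the real derivative \<open>D\<close>,
  a description free of coordinates; both sides are compared by expanding \<open>D\<close> over the
  real basis.\<close>

lemma row_apply_wirtinger_row:
  fixes \<rho> :: "complex ^ 'n \<Rightarrow> real"
  assumes D: "(\<rho> has_derivative D) (at z)"
  shows "row_apply (wirtinger_row \<rho> z) v = (D v - \<i> * D (\<i> *s v)) / 2"
proof -
  have dir: "deriv (\<lambda>t::real. \<rho> (z + axis j (a * of_real t))) 0 = D (axis j a)" for j a
  proof -
    have ax: "axis j (a * of_real t) = t *\<^sub>R axis j a" for t
      by (simp add: vec_eq_iff axis_def scaleR_conv_of_real[where 'a = complex])
    show ?thesis
      using directional_derivative[OF D, of "axis j a"] by (simp add: ax DERIV_imp_deriv)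
  qed
  interpret D: bounded_linear D
    using has_derivative_bounded_linear[OF D] .
  have decomp: "D v = (\<Sum>j\<in>UNIV. Re (v $ j) * D (axis j 1) + Im (v $ j) * D (axis j \<i>))" for v
  proof -
    have "v = (\<Sum>j\<in>UNIV. Re (v $ j) *\<^sub>R axis j 1 + Im (v $ j) *\<^sub>R axis j \<i>)"
      by (simp add: vec_eq_iff axis_def sum.distrib if_distrib[where f = "(*\<^sub>R) c" for c]
          cong: if_cong) (simp add: complex_eq_iff)
    then have "D v = D (\<Sum>j\<in>UNIV. Re (v $ j) *\<^sub>R axis j 1 + Im (v $ j) *\<^sub>R axis j \<i>)"
      by simp
    then show ?thesis
      by (simp add: D.sum D.add D.scaleR)
  qed
  have "wirtinger_row \<rho> z $ j = (D (axis j 1) - \<i> * D (axis j \<i>)) / 2" for j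
    using dir[of j 1] dir[of j \<i>] by (simp add: wirtinger_row_def)
  then have "row_apply (wirtinger_row \<rho> z) v =
      (\<Sum>j\<in>UNIV. (D (axis j 1) - \<i> * D (axis j \<i>)) / 2 * v $ j)"
    by (simp only: row_apply_def)
  also have "\<dots> = (D v - \<i> * D (\<i> *s v)) / 2"
    unfolding decomp[of v] decomp[of "\<i> *s v"]
    by (simp add: sum_distrib_left sum_divide_distrib flip: sum_subtractf)
      (auto intro!: sum.cong simp: complex_eq_iff algebra_simps diff_divide_distrib add_divide_distrib)
  finally show ?thesis .
qed

lemma minkowski_functionalD:
  assumes "is_minkowski_functional \<rho> \<Omega>"
  shows "continuous_on UNIV \<rho>" "\<rho> z \<ge> 0" "\<rho> z = 0 \<longleftrightarrow> z = 0" "\<rho> (t *s z) = cmod t * \<rho> z"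
    "z \<in> \<Omega> \<longleftrightarrow> \<rho> z < 1"
  using assms unfolding is_minkowski_functional_def by auto

text \<open>Euler's relation. Homogeneity gives derivative \<open>\<rho> z\<close> in direction
  \<open>z\<close>. In direction \<open>\<i> *s z\<close> it gives 0, because |1 + it| = sqrt (1 +
  t^2) is stationary at t = 0.\<close>

lemma row_apply_wirtinger_row_self:
  assumes \<rho>: "is_minkowski_functional \<rho> \<Omega>" and D: "(\<rho> has_derivative D) (at z)"
  shows "row_apply (wirtinger_row \<rho> z) z = \<rho> z / 2"
proof -
  have dir: "((\<lambda>t. cmod (1 + of_real t * a) * \<rho> z) has_real_derivative D (a *s z)) (at 0)" for a
  proof -
    have line: "z + t *\<^sub>R (a *s z) = (1 + of_real t * a) *s z" for t
      by (simp add: vec_eq_iff scaleR_conv_of_real[where 'a = complex] algebra_simps)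
    show ?thesis
      using directional_derivative[OF D, of "a *s z"]
      unfolding line minkowski_functionalD(4)[OF \<rho>] .
  qed
  have "((\<lambda>t. cmod (1 + of_real t * 1) * \<rho> z) has_real_derivative 1 * \<rho> z) (at 0)"
  proof (rule DERIV_cmult_right, rule has_field_derivative_transform_within_open)
    show "((\<lambda>t. 1 + t) has_real_derivative 1) (at 0)"
      by (auto intro!: derivative_eq_intros)
    show "1 + t = cmod (1 + of_real t * 1)" if "t \<in> {-1<..}" for t
      using that norm_of_real[of "1 + t", where 'a = complex] by simp
  qed auto
  from DERIV_unique[OF this dir[of 1]] have 1: "D z = \<rho> z"
    by simp
  have "((\<lambda>t. sqrt (1 + t\<^sup>2)) has_real_derivative 0) (at 0)"
    by (auto intro!: derivative_eq_intros)
  from DERIV_cmult_right[OF this, of "\<rho> z"]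
  have "((\<lambda>t. cmod (1 + of_real t * \<i>) * \<rho> z) has_real_derivative 0) (at 0)"
    by (simp add: cmod_def)
  from DERIV_unique[OF this dir[of \<i>]] have 2: "D (\<i> *s z) = 0"
    by simp
  show ?thesis
    using row_apply_wirtinger_row[OF D, of z] 1 2 by simp
qed

text \<open>Forces 0 into the exceptional set, so that dividing by \<open>\<rho> z\<close> is
  legitimate off it. On a real line through 0 the functional is a positive multiple of |t|, whose
  one-sided difference quotients are 1 and -1.\<close>

lemma minkowski_functional_not_differentiable_0:
  assumes \<rho>: "is_minkowski_functional \<rho> (\<Omega> :: (complex ^ 'n) set)"
  shows "\<not> (\<rho> has_derivative D) (at 0)"
proof
  assume D: "(\<rho> has_derivative D) (at 0)"
  define v :: "complex ^ 'n" where "v = axis undefined 1"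
  have v: "\<rho> v > 0"
    using minkowski_functionalD(2,3)[OF \<rho>, of v] by (simp add: v_def axis_eq_0_iff less_le)
  have "t *\<^sub>R v = of_real t *s v" for t
    by (simp add: vec_eq_iff scaleR_conv_of_real[where 'a = complex])
  then have "((\<lambda>t. \<bar>t\<bar> * \<rho> v) has_real_derivative D v) (at 0)"
    using directional_derivative[OF D, of v] by (simp add: minkowski_functionalD(4)[OF \<rho>])
  from DERIV_cmult_right[OF this, of "1 / \<rho> v"]
  have "(abs has_real_derivative D v / \<rho> v) (at 0)"
    using v by simp
  then have lim: "((\<lambda>h. \<bar>h\<bar> / h) \<longlongrightarrow> D v / \<rho> v) (at 0)"
    by (simp add: DERIV_def)
  have "((\<lambda>h. \<bar>h\<bar> / h) \<longlongrightarrow> 1) (at_right (0::real))"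
    by (rule tendsto_eventually) (auto simp: eventually_at_filter)
  then have 1: "D v / \<rho> v = 1"
    using lim by (meson filterlim_at_split tendsto_unique trivial_limit_at_right_real)
  have "((\<lambda>h. \<bar>h\<bar> / h) \<longlongrightarrow> -1) (at_left (0::real))"
    by (rule tendsto_eventually) (auto simp: eventually_at_filter)
  then have "D v / \<rho> v = -1"
    using lim by (meson filterlim_at_split tendsto_unique trivial_limit_at_left_real)
  with 1 show False
    by simp
qed

subsection \<open>Radial coefficients\<close>

text \<open>On the line through \<open>z\<close>, \<open>F\<close> is \<zeta> times the slice of
  \<open>f\<close>, times \<open>z\<close>. The extra factor \<zeta> shifts the order by one and
  contributes \<open>Suc k\<close>, which turns \<open>fact (Suc k)\<close> into
  \<open>fact k\<close>. The factor 2 in \<open>radial_coeff\<close> cancels the 1/2 from Euler's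
  relation.\<close>

lemma radial_coeff_scale_self:
  assumes \<rho>: "is_minkowski_functional \<rho> \<Omega>" and D: "(\<rho> has_derivative D) (at z)" and z: "z \<noteq> 0"
    and \<Omega>: "open \<Omega>" and f: "holomorphic_fun_on f \<Omega>" and F: "\<And>w. w \<in> \<Omega> \<Longrightarrow> F w = f w *s w"
  shows "radial_coeff \<rho> F (Suc k) z = (deriv ^^ k) (\<lambda>\<zeta>. f (\<zeta> *s z)) 0 / (fact k * \<rho> z ^ k)"
proof -
  define \<phi> where "\<phi> \<zeta> = f (\<zeta> *s z)" for \<zeta>
  define T where "T = {\<zeta>. \<zeta> *s z \<in> \<Omega>}"
  have T: "open T" "0 \<in> T"
    unfolding T_def using open_line_preimage[OF \<Omega>] minkowski_functionalD(3,5)[OF \<rho>, of 0] by auto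
  have Fj: "holomorphic_fun_on (\<lambda>w. F w $ j) \<Omega>" for j
    unfolding holomorphic_fun_on_def
  proof
    fix w assume w: "w \<in> \<Omega>"
    let ?D = "\<lambda>h. f w *s h + frechet_derivative f (at w) h *s w"
    have "((\<lambda>w. F w $ j) has_derivative (\<lambda>h. ?D h $ j)) (at w)"
      using has_derivative_scale_self[OF \<Omega> f F w] bounded_linear.has_derivative[OF bounded_linear_vec_nth]
      by blast
    moreover have "Vector_Spaces.linear (*s) (*) (\<lambda>h. ?D h $ j)"
      using linear_scale_self[OF f w] unfolding linear_scale_vec_iff linear_scale_mult_iff
      by (simp add: distrib_left)
    ultimately show "\<exists>D. ((\<lambda>w. F w $ j) has_derivative D) (at w) \<and> Vector_Spaces.linear (*s) (*) D"
      by blast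
  qed
  have hol: "(\<lambda>\<zeta>. u (\<zeta> *s z)) holomorphic_on T" if "holomorphic_fun_on u \<Omega>" for u
    unfolding holomorphic_on_open[OF T(1)]
    using holomorphic_fun_on_line[OF that, of 0 _ z] by (auto simp: T_def)
  have "frechet_power (Suc k) F 0 z = (of_nat (Suc k) * (deriv ^^ k) \<phi> 0) *s z"
  proof (subst vec_eq_iff, intro allI)
    fix j
    have "frechet_power (Suc k) F 0 z $ j =
        iterated_frechet (\<lambda>w. F w $ j) (replicate (Suc k) z) (0 *s z)"
      unfolding frechet_power_def using iterated_frechet_component[OF \<Omega> Fj, of 0] T(2)
      by (simp add: T_def del: iterated_frechet.simps replicate.simps)
    also have "\<dots> = (deriv ^^ Suc k) (\<lambda>\<zeta>. F (\<zeta> *s z) $ j) 0"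
      using T(2) by (intro iterated_frechet_line[OF \<Omega> Fj]) (simp add: T_def)
    also have "\<dots> = (deriv ^^ Suc k) (\<lambda>\<zeta>. (z $ j * \<zeta>) * \<phi> \<zeta>) 0"
    proof (rule higher_deriv_transform_within_open[OF _ _ T])
      show "(\<lambda>\<zeta>. F (\<zeta> *s z) $ j) holomorphic_on T"
        by (rule hol[OF Fj])
      show "(\<lambda>\<zeta>. (z $ j * \<zeta>) * \<phi> \<zeta>) holomorphic_on T"
        unfolding \<phi>_def by (intro holomorphic_intros hol[OF f])
    qed (simp add: T_def F \<phi>_def)
    also have "\<dots> = (\<Sum>i=0..Suc k. of_nat (Suc k choose i) * (deriv ^^ i) (\<lambda>\<zeta>. z $ j * \<zeta>) 0
        * (deriv ^^ (Suc k - i)) \<phi> 0)"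
      unfolding \<phi>_def by (intro higher_deriv_mult[OF _ _ T] holomorphic_intros hol[OF f])
    \<comment> \<open>At 0 only the first derivative of the linear factor survives in the Leibniz
      sum.\<close>
    also have "\<dots> = (\<Sum>i\<in>{1}. of_nat (Suc k choose i) * (deriv ^^ i) (\<lambda>\<zeta>. z $ j * \<zeta>) 0
        * (deriv ^^ (Suc k - i)) \<phi> 0)"
    proof (rule sum.mono_neutral_right)
      have "(deriv ^^ i) (\<lambda>\<zeta>. z $ j * \<zeta>) 0 = 0" if "i \<noteq> 1" for i
        using that by (simp add: higher_deriv_linear)
      then show "\<forall>i\<in>{0..Suc k} - {1}. of_nat (Suc k choose i) * (deriv ^^ i) (\<lambda>\<zeta>. z $ j * \<zeta>) 0
          * (deriv ^^ (Suc k - i)) \<phi> 0 = 0"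
        by simp
    qed auto
    also have "\<dots> = ((of_nat (Suc k) * (deriv ^^ k) \<phi> 0) *s z) $ j"
      by (simp add: higher_deriv_linear)
    finally show "frechet_power (Suc k) F 0 z $ j = ((of_nat (Suc k) * (deriv ^^ k) \<phi> 0) *s z) $ j" .
  qed
  then have "(1 / (fact (Suc k) * \<rho> z ^ Suc k)) *\<^sub>R frechet_power (Suc k) F 0 z =
      (of_real (1 / (fact (Suc k) * \<rho> z ^ Suc k)) * (of_nat (Suc k) * (deriv ^^ k) \<phi> 0)) *s z"
    by (simp only: vec_eq_iff vector_scaleR_component scaleR_conv_of_real[where 'a = complex]
        vector_smult_component mult.assoc) simp
  then have "radial_coeff \<rho> F (Suc k) z = 2 * ((of_real (1 / (fact (Suc k) * \<rho> z ^ Suc k)) *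
      (of_nat (Suc k) * (deriv ^^ k) \<phi> 0)) * (of_real (\<rho> z / 2)))"
    unfolding radial_coeff_def
    by (simp only: row_apply_scale row_apply_wirtinger_row_self[OF \<rho> D])
  also have "\<dots> = (deriv ^^ k) \<phi> 0 / (fact k * \<rho> z ^ k)"
    using minkowski_functionalD(3)[OF \<rho>, of z] z by (simp add: field_simps del: of_nat_Suc)
  finally show ?thesis
    unfolding \<phi>_def .
qed

text \<open>The radius is not normalized to 1: with \<open>R = 1 / \<rho> z\<close> the factor
  \<open>R ^ 3\<close> provides exactly the powers of \<open>\<rho> z\<close> in the three radial
  coefficients.\<close>

lemma starlike_coefficient_bound:
  fixes R :: real
  assumes \<phi>: "\<phi> holomorphic_on ball 0 R" and h: "h holomorphic_on ball 0 R" and R: "R > 0"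
    and \<phi>0: "\<phi> 0 = 1" and pos: "\<And>w. w \<in> ball 0 R \<Longrightarrow> Re (h w) \<ge> 0"
    and eq: "\<And>w. w \<in> ball 0 R \<Longrightarrow> h w * (\<phi> w + w * deriv \<phi> w) = \<phi> w"
  defines "b \<equiv> \<lambda>k. (deriv ^^ k) \<phi> 0 / fact k"
  shows "cmod (b 1 * b 2 - b 3) * R ^ 3 \<le> 2"
proof -
  define B where "B = ball (0::complex) R"
  have B: "open B" "0 \<in> B"
    using R by (simp_all add: B_def)
  note hol = \<phi>[folded B_def] h[folded B_def]
  define c where "c k = (deriv ^^ k) h 0 / fact k" for k
  have h0: "h 0 = 1"
    using eq[of 0] R \<phi>0 by simp
  have \<phi>': "(\<lambda>w. w * deriv \<phi> w) holomorphic_on B"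
    by (intro holomorphic_intros hol B)
  \<comment> \<open>\<open>g\<close> is the derivative of w \<phi>(w), which explains the factor
    \<open>n + 1\<close> in its \<open>n\<close>-th derivative at 0.\<close>
  define g where "g w = \<phi> w + w * deriv \<phi> w" for w
  have gd: "(deriv ^^ n) g 0 = of_nat (n + 1) * (deriv ^^ n) \<phi> 0" for n
  proof -
    have "(deriv ^^ n) g 0 = (deriv ^^ n) \<phi> 0 + (deriv ^^ n) (\<lambda>w. w * deriv \<phi> w) 0"
      unfolding g_def by (rule higher_deriv_add[OF hol(1) \<phi>' B])
    also have "(deriv ^^ n) (\<lambda>w. w * deriv \<phi> w) 0 = (\<Sum>i=0..n. of_nat (n choose i) *
        (deriv ^^ i) (\<lambda>w. w) 0 * (deriv ^^ (n - i)) (deriv \<phi>) 0)"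
      by (intro higher_deriv_mult[OF _ _ B] holomorphic_intros hol B)
    also have "\<dots> = (\<Sum>i=0..n. if i = 1 then of_nat n * (deriv ^^ n) \<phi> 0 else 0)"
    proof (intro sum.cong refl)
      fix i assume "i \<in> {0..n}"
      then have "(deriv ^^ (n - 1)) (deriv \<phi>) = (deriv ^^ n) \<phi>" if "i = 1"
        using that by (cases n) (simp_all add: funpow_Suc_right del: funpow.simps)
      then show "of_nat (n choose i) * (deriv ^^ i) (\<lambda>w. w) 0 * (deriv ^^ (n - i)) (deriv \<phi>) 0 =
          (if i = 1 then of_nat n * (deriv ^^ n) \<phi> 0 else 0)"
        by (simp add: higher_deriv_ident)
    qed
    also have "\<dots> = of_nat n * (deriv ^^ n) \<phi> 0"
      by (cases n) simp_all
    finally show ?thesis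
      by (simp add: algebra_simps)
  qed
  have rec: "(\<Sum>i=0..n. of_nat (n choose i) * (deriv ^^ i) h 0 * (of_nat (n - i + 1) * (deriv ^^ (n - i)) \<phi> 0))
      = (deriv ^^ n) \<phi> 0" for n
  proof -
    have "g holomorphic_on B"
      unfolding g_def by (intro holomorphic_intros hol B)
    then have hg: "(\<lambda>w. h w * g w) holomorphic_on B"
      and "(deriv ^^ n) (\<lambda>w. h w * g w) 0 =
        (\<Sum>i=0..n. of_nat (n choose i) * (deriv ^^ i) h 0 * (deriv ^^ (n - i)) g 0)"
      by (auto intro: holomorphic_intros hol higher_deriv_mult[OF hol(2) _ B])
    moreover have "(deriv ^^ n) (\<lambda>w. h w * g w) 0 = (deriv ^^ n) \<phi> 0"
      by (rule higher_deriv_transform_within_open[OF hg hol(1) B]) (use eq in \<open>simp add: g_def B_def\<close>)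
    ultimately show ?thesis
      by (simp add: gd)
  qed
  \<comment> \<open>The recursion for \<open>n = 1, 2, 3\<close> is solved in unnormalized
    derivatives; the factorials return in \<open>bc\<close>.\<close>
  define p where "p k = (deriv ^^ k) \<phi> 0" for k
  define q where "q k = (deriv ^^ k) h 0" for k
  have 1: "2 * p 1 + q 1 = p 1"
    using rec[of 1] by (simp add: p_def q_def h0 \<phi>0)
  have 2: "3 * p 2 + 4 * q 1 * p 1 + q 2 = p 2"
    using rec[of 2] by (simp add: p_def q_def h0 \<phi>0 numeral_2_eq_2 algebra_simps)
  have 3: "4 * p 3 + 9 * q 1 * p 2 + 6 * q 2 * p 1 + q 3 = p 3"
    using rec[of 3] by (simp add: p_def q_def h0 \<phi>0 numeral_3_eq_3 numeral_2_eq_2 algebra_simps)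
  have p1: "p 1 = - q 1"
    using 1 by (simp add: algebra_simps add_eq_0_iff)
  have "2 * p 2 = 4 * q 1 ^ 2 - q 2"
    using 2 p1 by (simp add: algebra_simps power2_eq_square)
  then have p2: "p 2 = (4 * q 1 ^ 2 - q 2) / 2"
    by (simp add: mult.commute)
  have "3 * p 3 = - (9 * q 1 * p 2 + 6 * q 2 * p 1 + q 3)"
    using 3 by (simp add: algebra_simps add_eq_0_iff)
  then have p3: "p 3 = - (9 * q 1 * p 2 + 6 * q 2 * p 1 + q 3) / 3"
    by (simp add: eq_divide_eq mult.commute)
  have "p 1 * (p 2 / 2) - p 3 / 6 = (q 3 / 6 - q 1 * q 2 / 2 - q 1 * (q 2 / 2)) / 3"
    unfolding p3 p2 p1 by (simp add: field_simps power2_eq_square)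
  \<comment> \<open>The grouping separates one Livingston difference, bounded by 2, from one
    product, bounded by 4; the division by 3 then gives 2.\<close>
  then have bc: "b 1 * b 2 - b 3 = ((c 3 - c 2 * c 1) - c 2 * c 1) / 3"
    by (simp add: b_def c_def p_def q_def fact_numeral mult_ac)
  \<comment> \<open>The integral estimates live on circles strictly inside the disc; the radius
    tends to \<open>R\<close> only at the end.\<close>
  have bound: "cmod (b 1 * b 2 - b 3) * r ^ 3 \<le> 2" if r: "0 < r" "r < R" for r
  proof -
    have coef: "r ^ k / fact k * (deriv ^^ k) h 0 = r ^ k * c k" for k
      by (simp add: c_def)
    have "cmod (r ^ k * c k) \<le> 2" if "k \<ge> 1" for k
      using caratheodory_bounds(1)[OF h h0 pos r that that] by (simp add: c_def mult_ac)
    from mult_mono[OF this[of 2] this[of 1]]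
    have le4: "cmod (r ^ 3 * (c 2 * c 1)) \<le> 4"
      by (simp add: norm_mult norm_power power3_eq_cube power2_eq_square mult_ac)
    have "cmod (r ^ 3 * (c 3 - c 2 * c 1)) \<le> 2"
      using caratheodory_bounds(2)[OF h h0 pos r, of 2 1] unfolding coef
      by (simp add: numeral_3_eq_3[symmetric] power3_eq_cube power2_eq_square algebra_simps)
    with le4 have "cmod (r ^ 3 * (c 3 - c 2 * c 1) - r ^ 3 * (c 2 * c 1)) \<le> 6"
      using norm_triangle_ineq4 by (smt (verit))
    moreover have "r ^ 3 * (c 3 - c 2 * c 1) - r ^ 3 * (c 2 * c 1) = 3 * (r ^ 3 * (b 1 * b 2 - b 3))"
      unfolding bc by (simp add: algebra_simps)
    ultimately have "cmod (3 * (r ^ 3 * (b 1 * b 2 - b 3))) \<le> 6"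
      by simp
    then show ?thesis
      using r by (simp add: norm_mult norm_power mult_ac)
  qed
  have "((\<lambda>r. cmod (b 1 * b 2 - b 3) * r ^ 3) \<longlongrightarrow> cmod (b 1 * b 2 - b 3) * R ^ 3) (at_left R)"
    by (intro tendsto_intros)
  moreover have "eventually (\<lambda>r. cmod (b 1 * b 2 - b 3) * r ^ 3 \<le> 2) (at_left R)"
    unfolding eventually_at_left[OF R] using bound R by (intro exI[of _ 0]) simp
  ultimately show ?thesis
    by (rule tendsto_upperbound) simp
qed

subsection \<open>Starlikeness and the extremal map\<close>

text \<open>
  The domain need not be convex, so Hahn--Banach does not give a norming functional at every boundary
  point. At a boundary point \<open>u\<close> of maximal Euclidean norm, the functional
  \<open>\<langle>z, u\<rangle> / \<parallel>u\<parallel>\<^sup>2\<close> works.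
\<close>
lemma contracting_functional_exists:
  fixes \<Omega> :: "(complex ^ 'n) set"
  assumes \<Omega>: "bounded \<Omega>" and \<rho>: "is_minkowski_functional \<rho> \<Omega>"
  obtains L u where "Vector_Spaces.linear (*s) (*) L" "bounded_linear L" "\<rho> u = 1" "L u = 1"
    "\<And>z. cmod (L z) \<le> \<rho> z"
proof -
  note \<rho>D = minkowski_functionalD[OF \<rho>]
  define K where "K = {z. \<rho> z \<le> 1}"
  have normalize: "(1 / \<rho> z) *s z \<in> K" "norm ((1 / \<rho> z) *s z) = norm z / \<rho> z" if "z \<noteq> 0" for z
    using \<rho>D(2)[of z] \<rho>D(3)[of z] that
    by (simp_all add: K_def \<rho>D(4) norm_vector_scale norm_divide)
  obtain B where B: "\<And>z. z \<in> \<Omega> \<Longrightarrow> norm z \<le> B"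
    using \<Omega> bounded_iff by blast
  \<comment> \<open>Halving a vector of \<open>K\<close> brings it into the bounded set
    \<open>\<Omega>\<close>, because \<open>\<rho>\<close> becomes at most 1/2.\<close>
  have "norm z \<le> 2 * B" if "z \<in> K" for z
    using B[of "(1 / 2) *s z"] that by (simp add: K_def \<rho>D(4,5) norm_vector_scale norm_divide)
  then have "bounded K"
    using bounded_iff by blast
  moreover have "closed K"
    unfolding K_def using \<rho>D(1) by (intro closed_Collect_le continuous_intros)
  ultimately have "compact K"
    by (simp add: compact_eq_bounded_closed)
  moreover have "0 \<in> K"
    using \<rho>D(3)[of 0] by (simp add: K_def)
  ultimately obtain u where u: "u \<in> K" "\<And>z. z \<in> K \<Longrightarrow> norm z \<le> norm u"
    using continuous_attains_sup[of K norm] continuous_on_norm_id by blast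
  define e where "e = (axis undefined 1 :: complex ^ 'n)"
  have "e \<noteq> 0"
    by (simp add: e_def axis_eq_0_iff)
  then have "norm e / \<rho> e > 0"
    using \<rho>D(2)[of e] \<rho>D(3)[of e] by (simp add: less_le)
  then have u0: "norm u > 0"
    using u(2)[OF normalize(1)] normalize(2) \<open>e \<noteq> 0\<close> by fastforce
  define L where "L z = (\<Sum>j\<in>UNIV. cnj (u $ j) * z $ j) / (norm u)\<^sup>2" for z
  have lin: "Vector_Spaces.linear (*s) (*) L"
    unfolding linear_scale_mult_iff
    by (simp add: L_def sum.distrib sum_distrib_left add_divide_distrib distrib_left mult_ac)
  have bl: "bounded_linear L"
    unfolding L_def
    by (intro bounded_linear_divide[THEN bounded_linear_compose] bounded_linear_sum
        bounded_linear_mult_right[THEN bounded_linear_compose] bounded_linear_vec_nth)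
  have Lu: "L u = 1"
  proof -
    have "(\<Sum>j\<in>UNIV. cnj (u $ j) * u $ j) = of_real (\<Sum>j\<in>UNIV. (cmod (u $ j))\<^sup>2)"
      unfolding of_real_sum by (intro sum.cong refl) (metis complex_norm_square mult.commute)
    also have "\<dots> = (norm u)\<^sup>2"
      by (simp add: norm_vec_def L2_set_def real_sqrt_pow2 sum_nonneg)
    finally show ?thesis
      using u0 by (simp add: L_def)
  qed
  have Lb: "cmod (L z) \<le> \<rho> z" for z
  proof (cases "z = 0")
    case False
    have "cmod (\<Sum>j\<in>UNIV. cnj (u $ j) * z $ j) \<le> (\<Sum>j\<in>UNIV. \<bar>cmod (u $ j)\<bar> * \<bar>cmod (z $ j)\<bar>)"
      by (rule order_trans[OF norm_sum]) (simp add: norm_mult)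
    also have "\<dots> \<le> norm u * norm z"
      unfolding norm_vec_def by (rule L2_set_mult_ineq)
    finally have "cmod (L z) \<le> norm u * norm z / (norm u)\<^sup>2"
      by (simp add: L_def norm_divide norm_power divide_right_mono)
    also have "\<dots> = norm z / norm u"
      using u0 by (simp add: power2_eq_square)
    \<comment> \<open>The vector \<open>z\<close> divided by \<open>\<rho> z\<close> lies in
      \<open>K\<close>, and \<open>u\<close> has maximal norm there.\<close>
    also have "\<dots> \<le> \<rho> z"
    proof -
      have "norm z / \<rho> z \<le> norm u"
        using u(2)[OF normalize(1)[OF False]] normalize(2)[OF False] by simp
      then show ?thesis
        using u0 \<rho>D(2)[of z] \<rho>D(3)[of z] False by (simp add: field_simps less_le)
    qed
    finally show ?thesis .
  qed (simp add: L_def \<rho>D(2))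
  have "\<rho> u = 1"
    using Lb[of u] Lu u(1) by (simp add: K_def)
  then show ?thesis
    using that lin bl Lu Lb by blast
qed

text \<open>After multiplying by the conjugate of the denominator, the real part of the numerator is
  1 - |a|^2.\<close>

lemma Re_cayley_pos:
  assumes "cmod a < 1"
  shows "Re ((1 - a) / (1 + a)) > 0"
proof -
  have "1 + a \<noteq> 0"
    using assms by (metis add_eq_0_iff norm_minus_cancel norm_one order_less_irrefl)
  have "(cmod a)\<^sup>2 < 1"
    using assms by (simp add: power_less_one_iff abs_square_less_1)
  then have "Re ((1 - a) * cnj (1 + a)) > 0"
    by (simp add: cmod_power2 algebra_simps) (simp add: power2_eq_square)
  moreover have "(1 - a) / (1 + a) = ((1 - a) * cnj (1 + a)) / of_real ((cmod (1 + a))\<^sup>2)"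
    by (rule complex_div_cnj)
  ultimately show ?thesis
    using \<open>1 + a \<noteq> 0\<close> by (simp only: Re_divide_of_real) simp
qed

text \<open>The induction runs on the closed form (k+1)! a^k / (1 - a\<zeta>)^(k+2), valid wherever
  the denominator is nonzero, and only then sets \<zeta> = 0.\<close>

lemma higher_deriv_koebe:
  "(deriv ^^ k) (\<lambda>\<zeta>. inverse ((1 - a * \<zeta>)\<^sup>2)) 0 = fact (Suc k) * (a :: complex) ^ k"
proof -
  define S where "S = {\<zeta>. a * \<zeta> \<noteq> 1}"
  have S: "open S"
    unfolding S_def by (intro open_Collect_neq continuous_intros)
  have "(deriv ^^ k) (\<lambda>\<zeta>. inverse ((1 - a * \<zeta>)\<^sup>2)) \<zeta> =
      fact (Suc k) * a ^ k * inverse ((1 - a * \<zeta>) ^ (k + 2))" if "\<zeta> \<in> S" for \<zeta>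
    using that
  proof (induction k arbitrary: \<zeta>)
    case (Suc k)
    have ne: "1 - a * \<zeta> \<noteq> 0"
      using Suc.prems by (simp add: S_def)
    have aux: "- (of_nat n * (- a * x ^ (n - Suc 0)) * inverse ((x ^ n) ^ Suc (Suc 0))) =
        of_nat n * a * inverse (x ^ Suc n)" if "x \<noteq> 0" for x :: complex and n
      using that by (cases n) (simp_all add: field_simps del: of_nat_Suc)
    have "((\<lambda>\<zeta>. inverse ((1 - a * \<zeta>) ^ (k + 2))) has_field_derivative
        of_nat (k + 2) * a * inverse ((1 - a * \<zeta>) ^ Suc (k + 2))) (at \<zeta>)"
    proof (rule DERIV_cong)
      show "((\<lambda>\<zeta>. inverse ((1 - a * \<zeta>) ^ (k + 2))) has_field_derivative
          - (of_nat (k + 2) * (- a * (1 - a * \<zeta>) ^ (k + 2 - Suc 0)) *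
            inverse (((1 - a * \<zeta>) ^ (k + 2)) ^ Suc (Suc 0)))) (at \<zeta>)"
        by (intro DERIV_inverse_fun DERIV_power) (use ne in \<open>auto intro!: derivative_eq_intros\<close>)
    qed (rule aux[OF ne])
    from DERIV_cmult[OF this, of "fact (Suc k) * a ^ k"]
    have "((\<lambda>\<zeta>. fact (Suc k) * a ^ k * inverse ((1 - a * \<zeta>) ^ (k + 2))) has_field_derivative
        fact (Suc (Suc k)) * a ^ Suc k * inverse ((1 - a * \<zeta>) ^ (Suc k + 2))) (at \<zeta>)"
      by (simp add: algebra_simps)
    then have "((deriv ^^ k) (\<lambda>\<zeta>. inverse ((1 - a * \<zeta>)\<^sup>2)) has_field_derivative
        fact (Suc (Suc k)) * a ^ Suc k * inverse ((1 - a * \<zeta>) ^ (Suc k + 2))) (at \<zeta>)"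
      by (rule has_field_derivative_transform_within_open[OF _ S Suc.prems]) (simp add: Suc.IH)
    then show ?case
      by (simp add: DERIV_imp_deriv)
  qed (simp add: power2_eq_square)
  from this[of 0] show ?thesis
    by (simp add: S_def)
qed

lemma Re_mult_of_real: "Re (x * of_real t) = Re x * t"
  by simp

lemma row_apply_starlike:
  assumes \<rho>: "is_minkowski_functional \<rho> \<Omega>" and D: "(\<rho> has_derivative D) (at z)"
    and \<Omega>: "open \<Omega>" and f: "holomorphic_fun_on f \<Omega>" and F: "\<And>w. w \<in> \<Omega> \<Longrightarrow> F w = f w *s w"
    and z: "z \<in> \<Omega>" and inv: "invertible (complex_jacobian F z)" and q: "f z + frechet_derivative f (at z) z \<noteq> 0"
  shows "row_apply (wirtinger_row \<rho> z) (matrix_inv (complex_jacobian F z) *v F z) =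
    f z / (f z + frechet_derivative f (at z) z) * of_real (\<rho> z / 2)"
  using matrix_inv_jacobian_scale_self[OF \<Omega> f F z inv q]
  by (simp only: row_apply_scale row_apply_wirtinger_row_self[OF \<rho> D])

text \<open>Off \<open>E\<close> the real part of the ratio is positive. The set where it is
  negative is open by continuity and contained in \<open>E\<close>, hence empty.\<close>

lemma starlike_ratio_Re_nonneg:
  fixes \<Omega> E :: "(complex ^ 'n) set"
  assumes \<Omega>: "open \<Omega>" and \<rho>: "is_minkowski_functional \<rho> \<Omega>"
    and E: "consists_of_lower_dim_manifolds E" and C1: "C1_outside \<rho> E"
    and f: "holomorphic_fun_on f \<Omega>" "f 0 = 1" and F: "\<And>w. w \<in> \<Omega> \<Longrightarrow> F w = f w *s w"
    and star: "F \<in> starlike_maps \<Omega> \<rho> E" and w: "w \<in> \<Omega>"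
  shows "f w + frechet_derivative f (at w) w \<noteq> 0"
    and "Re (f w / (f w + frechet_derivative f (at w) w)) \<ge> 0"
proof -
  define q where "q w = f w + frechet_derivative f (at w) w" for w
  have D0: "frechet_derivative f (at w) 0 = 0" if "w \<in> \<Omega>" for w
    using holomorphic_fun_onD(2)[OF f(1) that, of 0 0] by simp
  have inv: "invertible (complex_jacobian F w)" if "w \<in> \<Omega>" for w
    using star that unfolding starlike_maps_def by blast
  have q: "q w \<noteq> 0" if w: "w \<in> \<Omega>" for w
  \<comment> \<open>At 0 there is no eigenvector to argue with, but there the value is
    \<open>f 0 = 1\<close>.\<close>
  proof (cases "w = 0")
    case True
    then show ?thesis
      using D0[OF w] f(2) by (simp add: q_def)
  next
    case False
    then show ?thesis
      unfolding q_def using invertible_jacobian_scale_self(1)[OF \<Omega> f(1) F w inv[OF w]] by blast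
  qed
  \<comment> \<open>Here the direction moves with the base point; expanding it in the standard basis
    reduces the claim to fixed directions.\<close>
  have cont_D: "continuous_on \<Omega> (\<lambda>w. frechet_derivative f (at w) w)"
  proof -
    have "continuous_on \<Omega> (\<lambda>w. \<Sum>j\<in>UNIV. w $ j * frechet_derivative f (at w) (axis j 1))"
      by (intro continuous_intros continuous_on_frechet_derivative[OF \<Omega> f(1)])
    moreover have "(\<Sum>j\<in>UNIV. w $ j * frechet_derivative f (at w) (axis j 1)) = frechet_derivative f (at w) w"
      if "w \<in> \<Omega>" for w
    proof -
      interpret D: bounded_linear "frechet_derivative f (at w)"
        using has_derivative_bounded_linear[OF holomorphic_fun_onD(1)[OF f(1) that]] .
      have "frechet_derivative f (at w) w = frechet_derivative f (at w) (\<Sum>j\<in>UNIV. w $ j *s axis j 1)"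
        by (simp add: basis_expansion)
      then show ?thesis
        by (simp add: D.sum holomorphic_fun_onD(2)[OF f(1) that])
    qed
    ultimately show ?thesis
      by (rule continuous_on_eq)
  qed
  define H where "H w = Re (f w / q w)" for w
  have "continuous_on \<Omega> H"
    unfolding H_def q_def using q holomorphic_fun_on_continuous[OF f(1)] cont_D
    by (intro continuous_intros) (auto simp: q_def)
  then have "open (\<Omega> \<inter> H -` {..<0})"
    by (intro continuous_open_preimage \<Omega>) auto
  moreover have "\<Omega> \<inter> H -` {..<0} \<subseteq> E"
  proof
    fix z assume z: "z \<in> \<Omega> \<inter> H -` {..<0}"
    show "z \<in> E"
    proof (rule ccontr)
      assume "z \<notin> E"
      then obtain D where D: "(\<rho> has_derivative D) (at z)"
        using C1 unfolding C1_outside_def by blast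
      have "Re (row_apply (wirtinger_row \<rho> z) (matrix_inv (complex_jacobian F z) *v F z)) > 0"
        using star z \<open>z \<notin> E\<close> unfolding starlike_maps_def by blast
      then have "Re (f z / q z * of_real (\<rho> z / 2)) > 0"
        using row_apply_starlike[OF \<rho> D \<Omega> f(1) F _ inv] q[of z] z by (simp add: q_def)
      then have "H z * (\<rho> z / 2) > 0"
        unfolding H_def by (simp only: Re_mult_of_real)
      then show False
        using z minkowski_functionalD(2)[OF \<rho>, of z] by (simp add: zero_less_mult_iff)
    qed
  qed
  ultimately have "\<Omega> \<inter> H -` {..<0} \<subseteq> interior E"
    by (rule interior_maximal[rotated])
  then have "\<Omega> \<inter> H -` {..<0} = {}"
    unfolding interior_lower_dim_manifolds[OF E] by blast
  then have "\<not> H w < 0"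
    using w by blast
  then show "f w + frechet_derivative f (at w) w \<noteq> 0"
    and "Re (f w / (f w + frechet_derivative f (at w) w)) \<ge> 0"
    using q[OF w] by (simp_all add: H_def q_def)
qed

lemma radial_coeff_starlike_bound:
  fixes \<Omega> E :: "(complex ^ 'n) set"
  assumes \<Omega>: "open \<Omega>" and \<rho>: "is_minkowski_functional \<rho> \<Omega>"
    and E: "consists_of_lower_dim_manifolds E" and C1: "C1_outside \<rho> E"
    and f: "holomorphic_fun_on f \<Omega>" "f 0 = 1" and F: "\<And>w. w \<in> \<Omega> \<Longrightarrow> F w = f w *s w"
    and star: "F \<in> starlike_maps \<Omega> \<rho> E" and z: "z \<in> \<Omega> - E"
  shows "cmod (radial_coeff \<rho> F 2 z * radial_coeff \<rho> F 3 z - radial_coeff \<rho> F 4 z) \<le> 2"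
proof -
  note \<rho>D = minkowski_functionalD[OF \<rho>]
  obtain D where D: "(\<rho> has_derivative D) (at z)"
    using C1 z unfolding C1_outside_def by blast
  have z0: "z \<noteq> 0"
    using minkowski_functional_not_differentiable_0[OF \<rho>] D by blast
  then have \<rho>z: "\<rho> z > 0"
    using \<rho>D(2)[of z] \<rho>D(3)[of z] by (simp add: less_le)
  define R where "R = 1 / \<rho> z"
  define \<phi> where "\<phi> \<zeta> = f (\<zeta> *s z)" for \<zeta>
  define h where "h \<zeta> = \<phi> \<zeta> / (\<phi> \<zeta> + \<zeta> * deriv \<phi> \<zeta>)" for \<zeta>
  \<comment> \<open>By homogeneity this disc is exactly the set of \<zeta> with
    \<open>\<zeta> *s z\<close> in \<open>\<Omega>\<close>.\<close>
  have in\<Omega>: "\<zeta> *s z \<in> \<Omega>" if "\<zeta> \<in> ball 0 R" for \<zeta>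
    using that \<rho>z by (simp add: \<rho>D(4,5) R_def field_simps)
  have \<phi>': "(\<phi> has_field_derivative frechet_derivative f (at (\<zeta> *s z)) z) (at \<zeta>)"
    if "\<zeta> \<in> ball 0 R" for \<zeta>
    using holomorphic_fun_on_line[OF f(1), of 0 \<zeta> z] in\<Omega>[OF that] by (simp add: \<phi>_def[abs_def])
  \<comment> \<open>Complex linearity of the derivative moves the factor \<zeta> into its direction,
    so \<open>h\<close> is the ratio of the starlikeness condition restricted to the line.\<close>
  have radial: "\<phi> \<zeta> + \<zeta> * deriv \<phi> \<zeta> = f (\<zeta> *s z) + frechet_derivative f (at (\<zeta> *s z)) (\<zeta> *s z)"
    if "\<zeta> \<in> ball 0 R" for \<zeta>
    using \<phi>'[OF that] by (simp add: \<phi>_def DERIV_imp_deriv holomorphic_fun_onD(2)[OF f(1) in\<Omega>[OF that]])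
  note ratio = starlike_ratio_Re_nonneg[OF \<Omega> \<rho> E C1 f F star in\<Omega>]
  have ne: "\<phi> \<zeta> + \<zeta> * deriv \<phi> \<zeta> \<noteq> 0" and pos: "Re (h \<zeta>) \<ge> 0" if "\<zeta> \<in> ball 0 R" for \<zeta>
    using ratio[OF _ that] radial[OF that] by (simp_all add: h_def \<phi>_def)
  have hol: "\<phi> holomorphic_on ball 0 R"
    using \<phi>' holomorphic_on_open by blast
  have "cmod ((deriv ^^ 1) \<phi> 0 / fact 1 * ((deriv ^^ 2) \<phi> 0 / fact 2) - (deriv ^^ 3) \<phi> 0 / fact 3) * R ^ 3 \<le> 2"
  proof (rule starlike_coefficient_bound[where h = h])
    show "h holomorphic_on ball 0 R"
      unfolding h_def using ne by (intro holomorphic_intros hol) auto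
    show "h \<zeta> * (\<phi> \<zeta> + \<zeta> * deriv \<phi> \<zeta>) = \<phi> \<zeta>" if "\<zeta> \<in> ball 0 R" for \<zeta>
      using ne[OF that] by (simp add: h_def)
  qed (use hol pos \<rho>z f(2) in \<open>simp_all add: R_def \<phi>_def\<close>)
  moreover have rc: "radial_coeff \<rho> F (Suc k) z = (deriv ^^ k) \<phi> 0 / fact k * of_real R ^ k" for k
    using radial_coeff_scale_self[OF \<rho> D z0 \<Omega> f(1) F, of k]
    by (simp add: \<phi>_def[abs_def] R_def power_divide)
  have "radial_coeff \<rho> F 2 z = (deriv ^^ 1) \<phi> 0 / fact 1 * of_real R ^ 1"
    "radial_coeff \<rho> F 3 z = (deriv ^^ 2) \<phi> 0 / fact 2 * of_real R ^ 2"
    "radial_coeff \<rho> F 4 z = (deriv ^^ 3) \<phi> 0 / fact 3 * of_real R ^ 3"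
    using rc[of 1] rc[of 2] rc[of 3] by (simp_all only: Suc_1 Suc_numeral semiring_norm)
  then have "radial_coeff \<rho> F 2 z * radial_coeff \<rho> F 3 z - radial_coeff \<rho> F 4 z =
      ((deriv ^^ 1) \<phi> 0 / fact 1 * ((deriv ^^ 2) \<phi> 0 / fact 2) - (deriv ^^ 3) \<phi> 0 / fact 3) * of_real R ^ 3"
    by (simp only: power3_eq_cube power2_eq_square power_one_right) (simp only: algebra_simps)
  ultimately show ?thesis
    using \<rho>z by (simp only: norm_mult norm_power norm_of_real) (simp add: R_def)
qed

text \<open>Here \<open>f z\<close> plus its radial derivative is (1 + L z) / (1 - L z)^3, so the
  ratio in the starlikeness condition is the Cayley transform (1 - L z) / (1 + L z).\<close>

lemma koebe_map_starlike:
  fixes \<Omega> E :: "(complex ^ 'n) set"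
  assumes \<Omega>: "open \<Omega>" and \<rho>: "is_minkowski_functional \<rho> \<Omega>" and C1: "C1_outside \<rho> E"
    and lin: "Vector_Spaces.linear (*s) (*) L" and bl: "bounded_linear L" and L: "\<And>z. cmod (L z) \<le> \<rho> z"
  defines "f \<equiv> \<lambda>z. inverse ((1 - L z)\<^sup>2)"
  shows "holomorphic_fun_on f \<Omega>" and "(\<lambda>z. f z *s z) \<in> starlike_maps \<Omega> \<rho> E"
proof -
  note \<rho>D = minkowski_functionalD[OF \<rho>]
  note lin' = lin[unfolded linear_scale_mult_iff]
  have L1: "cmod (L z) < 1" if "z \<in> \<Omega>" for z
    using L[of z] that by (simp add: \<rho>D(5))
  then have ne: "1 - L z \<noteq> 0" "1 + L z \<noteq> 0" if "z \<in> \<Omega>" for z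
    using that by (metis norm_one order_less_irrefl eq_iff_diff_eq_0,
        metis add_eq_0_iff norm_minus_cancel norm_one order_less_irrefl)
  define D where "D z h = 2 * L h / (1 - L z) ^ 3" for z h
  have der: "(f has_derivative D z) (at z)" if "z \<in> \<Omega>" for z
  proof -
    have "((\<lambda>x. inverse ((1 - x)\<^sup>2)) has_field_derivative 2 / (1 - L z) ^ 3) (at (L z))"
    proof (rule DERIV_cong)
      show "((\<lambda>x. inverse ((1 - x)\<^sup>2)) has_field_derivative
          - (of_nat 2 * (- 1 * (1 - L z) ^ (2 - Suc 0)) * inverse (((1 - L z) ^ 2) ^ Suc (Suc 0)))) (at (L z))"
        by (intro DERIV_inverse_fun DERIV_power)
          (use ne[OF that] in \<open>auto intro!: derivative_eq_intros\<close>)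
      have "- (of_nat 2 * (- 1 * y ^ (2 - Suc 0)) * inverse ((y ^ 2) ^ Suc (Suc 0))) = 2 / y ^ 3"
        if "y \<noteq> 0" for y :: complex
        using that by (simp add: field_simps power2_eq_square power3_eq_cube)
      from this[OF ne(1)[OF that]]
      show "- (of_nat 2 * (- 1 * (1 - L z) ^ (2 - Suc 0)) * inverse (((1 - L z) ^ 2) ^ Suc (Suc 0))) =
          2 / (1 - L z) ^ 3" .
    qed
    from diff_chain_at[OF bounded_linear_imp_has_derivative[OF bl] this[unfolded has_field_derivative_def]]
    show ?thesis
      by (simp add: f_def o_def D_def[abs_def] mult_ac)
  qed
  have linD: "Vector_Spaces.linear (*s) (*) (D z)" for z
    using lin' unfolding linear_scale_mult_iff by (simp add: D_def distrib_left add_divide_distrib)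
  show f: "holomorphic_fun_on f \<Omega>"
    unfolding holomorphic_fun_on_def using der linD by blast
  define F where "F z = f z *s z" for z
  have F: "\<And>w. w \<in> \<Omega> \<Longrightarrow> F w = f w *s w"
    by (simp add: F_def)
  have fD: "frechet_derivative f (at z) = D z" if "z \<in> \<Omega>" for z
    using der[OF that] frechet_derivative_at by metis
  have q: "f z + frechet_derivative f (at z) z = (1 + L z) / (1 - L z) ^ 3" if "z \<in> \<Omega>" for z
  proof -
    have "inverse (y\<^sup>2) + 2 * (1 - y) / y ^ 3 = (1 + (1 - y)) / y ^ 3" if "y \<noteq> 0" for y :: complex
      using that by (simp add: field_simps power2_eq_square power3_eq_cube)
    from this[OF ne(1)[OF that]] show ?thesis
      unfolding fD[OF that] by (simp add: f_def D_def)
  qed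
  have q0: "f z + frechet_derivative f (at z) z \<noteq> 0" if "z \<in> \<Omega>" for z
    using ne[OF that] by (simp add: q[OF that])
  have inv: "invertible (complex_jacobian F z)" if "z \<in> \<Omega>" for z
    using invertible_jacobian_scale_self(2)[OF \<Omega> f F that _ q0[OF that]] ne[OF that] by (simp add: f_def)
  have zero: "0 \<in> \<Omega>"
    using \<rho>D(3)[of 0] by (simp add: \<rho>D(5))
  have L0: "L 0 = 0"
    using L[of 0] \<rho>D(3)[of 0] by simp
  have "F \<in> starlike_maps \<Omega> \<rho> E"
    unfolding starlike_maps_def
  proof (intro CollectI conjI ballI)
    show "holomorphic_map_on F \<Omega>"
      unfolding holomorphic_map_on_def
      using has_derivative_scale_self[OF \<Omega> f F] linear_scale_self[OF f] by blast
    show "F 0 = 0"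
      by (simp add: F_def)
    show "complex_jacobian F 0 = mat 1"
      unfolding matrix_eq by (simp add: complex_jacobian_scale_self[OF \<Omega> f F zero] f_def L0)
    fix z assume z: "z \<in> \<Omega> - E"
    obtain D' where D': "(\<rho> has_derivative D') (at z)"
      using C1 z unfolding C1_outside_def by blast
    then have "z \<noteq> 0"
      using minkowski_functional_not_differentiable_0[OF \<rho>] by blast
    then have \<rho>z: "\<rho> z > 0"
      using \<rho>D(2)[of z] \<rho>D(3)[of z] by (simp add: less_le)
    have "f z / (f z + frechet_derivative f (at z) z) = (1 - L z) / (1 + L z)"
    proof -
      have "inverse (y\<^sup>2) / (x / y ^ 3) = y / x" if "y \<noteq> 0" "x \<noteq> 0" for x y :: complex
        using that by (simp add: field_simps power2_eq_square power3_eq_cube)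
      from this[OF ne(1)[OF DiffD1[OF z]] ne(2)[OF DiffD1[OF z]]] show ?thesis
        unfolding q[OF DiffD1[OF z]] by (simp add: f_def)
    qed
    then have "row_apply (wirtinger_row \<rho> z) (matrix_inv (complex_jacobian F z) *v F z) =
        (1 - L z) / (1 + L z) * of_real (\<rho> z / 2)"
      using row_apply_starlike[OF \<rho> D' \<Omega> f F _ inv q0] z by simp
    then show "Re (row_apply (wirtinger_row \<rho> z) (matrix_inv (complex_jacobian F z) *v F z)) > 0"
      using Re_cayley_pos[OF L1[OF DiffD1[OF z]]] \<rho>z by (simp only: Re_mult_of_real) simp
  qed (use inv in auto)
  then show "(\<lambda>z. f z *s z) \<in> starlike_maps \<Omega> \<rho> E"
    by (simp add: F_def[abs_def])
qed

text \<open>Each slice of the scalar factor is the one-variable function 1 / (1 - a\<zeta>)^2 with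
  \<open>a = L z\<close>, whose Taylor coefficients are (k+1) a^k.\<close>

lemma radial_coeff_koebe_map:
  fixes \<Omega> :: "(complex ^ 'n) set"
  assumes \<rho>: "is_minkowski_functional \<rho> \<Omega>" and D: "(\<rho> has_derivative D) (at z)" and z: "z \<noteq> 0"
    and \<Omega>: "open \<Omega>" and lin: "Vector_Spaces.linear (*s) (*) L"
    and f: "holomorphic_fun_on (\<lambda>z. inverse ((1 - L z)\<^sup>2)) \<Omega>"
  shows "radial_coeff \<rho> (\<lambda>z. inverse ((1 - L z)\<^sup>2) *s z) (Suc k) z = of_nat (Suc k) * (L z / \<rho> z) ^ k"
proof -
  have "(\<lambda>\<zeta>. inverse ((1 - L (\<zeta> *s z))\<^sup>2)) = (\<lambda>\<zeta>. inverse ((1 - L z * \<zeta>)\<^sup>2))"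
    using lin unfolding linear_scale_mult_iff by (simp add: mult.commute)
  then show ?thesis
    using radial_coeff_scale_self[OF \<rho> D z \<Omega> f refl, of k]
    by (simp add: higher_deriv_koebe power_divide del: of_nat_Suc)
qed

theorem theorem6:
  fixes \<Omega> E :: "(complex ^ 'n) set" and \<rho> :: "complex ^ 'n \<Rightarrow> real"
  assumes "bounded_starlike_circular_domain \<Omega>"
    and "is_minkowski_functional \<rho> \<Omega>"
    and "consists_of_lower_dim_manifolds E"
    and "C1_outside \<rho> E"
  shows "(\<forall>f F. holomorphic_fun_on f \<Omega> \<and> f 0 = 1 \<and> (\<forall>z\<in>\<Omega>. F z = f z *s z) \<and>
              F \<in> starlike_maps \<Omega> \<rho> E \<longrightarrow>
            (\<forall>z\<in>\<Omega> - E.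
               cmod (radial_coeff \<rho> F 2 z * radial_coeff \<rho> F 3 z - radial_coeff \<rho> F 4 z) \<le> 2))
       \<and> (\<forall>c::real. c < 2 \<longrightarrow>
          \<not> (\<forall>f F. holomorphic_fun_on f \<Omega> \<and> f 0 = 1 \<and> (\<forall>z\<in>\<Omega>. F z = f z *s z) \<and>
                 F \<in> starlike_maps \<Omega> \<rho> E \<longrightarrow>
               (\<forall>z\<in>\<Omega> - E.
                  cmod (radial_coeff \<rho> F 2 z * radial_coeff \<rho> F 3 z - radial_coeff \<rho> F 4 z) \<le> c)))"
proof (intro conjI)
  have \<Omega>: "open \<Omega>" "bounded \<Omega>"
    using assms(1) by (simp_all add: bounded_starlike_circular_domain_def)
  note \<rho>D = minkowski_functionalD[OF assms(2)]
  show "\<forall>f F. holomorphic_fun_on f \<Omega> \<and> f 0 = 1 \<and> (\<forall>z\<in>\<Omega>. F z = f z *s z) \<and>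
              F \<in> starlike_maps \<Omega> \<rho> E \<longrightarrow>
            (\<forall>z\<in>\<Omega> - E.
               cmod (radial_coeff \<rho> F 2 z * radial_coeff \<rho> F 3 z - radial_coeff \<rho> F 4 z) \<le> 2)"
    using radial_coeff_starlike_bound[OF \<Omega>(1) assms(2-4)] by blast
  obtain L u where lin: "Vector_Spaces.linear (*s) (*) L" and bl: "bounded_linear L"
    and u: "\<rho> u = 1" "L u = 1" and L: "\<And>z. cmod (L z) \<le> \<rho> z"
    using contracting_functional_exists[OF \<Omega>(2) assms(2)] by metis
  define f where "f z = inverse ((1 - L z)\<^sup>2)" for z
  define F where "F z = f z *s z" for z
  note koebe = koebe_map_starlike[OF \<Omega>(1) assms(2,4) lin bl L]
  have f0: "f 0 = 1"
    using L[of 0] \<rho>D(3)[of 0] by (simp add: f_def)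
  show "\<forall>c::real. c < 2 \<longrightarrow>
          \<not> (\<forall>f F. holomorphic_fun_on f \<Omega> \<and> f 0 = 1 \<and> (\<forall>z\<in>\<Omega>. F z = f z *s z) \<and>
                 F \<in> starlike_maps \<Omega> \<rho> E \<longrightarrow>
               (\<forall>z\<in>\<Omega> - E.
                  cmod (radial_coeff \<rho> F 2 z * radial_coeff \<rho> F 3 z - radial_coeff \<rho> F 4 z) \<le> c))"
  proof (intro allI impI notI)
    fix c :: real assume c: "c < 2"
    assume sharp: "\<forall>f F. holomorphic_fun_on f \<Omega> \<and> f 0 = 1 \<and> (\<forall>z\<in>\<Omega>. F z = f z *s z) \<and>
                 F \<in> starlike_maps \<Omega> \<rho> E \<longrightarrow>
               (\<forall>z\<in>\<Omega> - E.
                  cmod (radial_coeff \<rho> F 2 z * radial_coeff \<rho> F 3 z - radial_coeff \<rho> F 4 z) \<le> c)"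
    have "holomorphic_fun_on f \<Omega> \<and> f 0 = 1 \<and> (\<forall>z\<in>\<Omega>. F z = f z *s z) \<and> F \<in> starlike_maps \<Omega> \<rho> E"
      using koebe f0 by (simp add: f_def[abs_def] F_def[abs_def])
    with sharp have le: "cmod (radial_coeff \<rho> F 2 z * radial_coeff \<rho> F 3 z - radial_coeff \<rho> F 4 z) \<le> c"
      if "z \<in> \<Omega> - E" for z
      using that by blast
    \<comment> \<open>With a = L z / \<open>\<rho> z\<close> the expression is 2a * 3a^2 - 4a^3 =
      2a^3. Unlike the radial coefficients, \<open>G\<close> is continuous on all of
      \<open>\<Omega> - {0}\<close>.\<close>
    define G where "G z = 2 * (cmod (L z) / \<rho> z) ^ 3" for z
    have val: "cmod (radial_coeff \<rho> F 2 z * radial_coeff \<rho> F 3 z - radial_coeff \<rho> F 4 z) = G z"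
      if z: "z \<in> \<Omega> - E" for z
    proof -
      obtain D where D: "(\<rho> has_derivative D) (at z)"
        using assms(4) z unfolding C1_outside_def by blast
      then have "z \<noteq> 0"
        using minkowski_functional_not_differentiable_0[OF assms(2)] by blast
      define a where "a = L z / \<rho> z"
      have "radial_coeff \<rho> F (Suc k) z = of_nat (Suc k) * a ^ k" for k
        using radial_coeff_koebe_map[OF assms(2) D \<open>z \<noteq> 0\<close> \<Omega>(1) lin koebe(1)]
        by (simp add: F_def[abs_def] f_def a_def)
      from this[of 1] this[of 2] this[of 3]
      have "radial_coeff \<rho> F 2 z = of_nat 2 * a ^ 1" "radial_coeff \<rho> F 3 z = of_nat 3 * a ^ 2"
        "radial_coeff \<rho> F 4 z = of_nat 4 * a ^ 3"
        by (simp_all only: Suc_1 Suc_numeral semiring_norm)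
      then have "radial_coeff \<rho> F 2 z = 2 * a" "radial_coeff \<rho> F 3 z = 3 * a ^ 2" "radial_coeff \<rho> F 4 z = 4 * a ^ 3"
        by simp_all
      then have "radial_coeff \<rho> F 2 z * radial_coeff \<rho> F 3 z - radial_coeff \<rho> F 4 z = 2 * a ^ 3"
        by (simp add: power2_eq_square power3_eq_cube)
      then show ?thesis
        using \<rho>D(2)[of z] by (simp add: G_def a_def norm_mult norm_power norm_divide)
    qed
    \<comment> \<open>The extremal point may lie in \<open>E\<close>, so no evaluation there is
      possible. Instead, a bound \<open>c\<close> would put the open set \<open>N\<close> inside
      \<open>E\<close>, which has empty interior.\<close>
    define N where "N = (\<Omega> - {0}) \<inter> G -` {c<..}"
    have "continuous_on (\<Omega> - {0}) G"
      unfolding G_def using \<rho>D(3) continuous_on_subset[OF \<rho>D(1)]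
      by (intro continuous_intros bounded_linear.continuous_on[OF bl]) auto
    then have "open N"
      unfolding N_def by (intro continuous_open_preimage open_delete \<Omega>(1)) auto
    moreover have "N \<subseteq> E"
      using le val unfolding N_def by fastforce
    ultimately have "N \<subseteq> interior E"
      by (rule interior_maximal[rotated])
    \<comment> \<open>\<open>u\<close> lies on the boundary; halving it moves it into
      \<open>\<Omega>\<close> and leaves \<open>G\<close> unchanged, since \<open>G\<close> is
      invariant under scaling.\<close>
    moreover have "(1 / 2) *s u \<in> N"
    proof -
      have Lu: "L ((1 / 2) *s u) = 1 / 2"
        using lin u(2) unfolding linear_scale_mult_iff by simp
      have \<rho>u: "\<rho> ((1 / 2) *s u) = 1 / 2"
        using u(1) by (simp add: \<rho>D(4) norm_divide)
      have "u \<noteq> 0"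
        using u(1) \<rho>D(3)[of u] by auto
      moreover have "G ((1 / 2) *s u) = 2"
        unfolding G_def Lu \<rho>u by (simp add: norm_divide)
      moreover have "(1 / 2) *s u \<in> \<Omega>"
        unfolding \<rho>D(5) \<rho>u by simp
      ultimately show ?thesis
        using c by (simp add: N_def)
    qed
    ultimately show False
      using interior_lower_dim_manifolds[OF assms(3)] by blast
  qed
qed

end
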